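(* Let $R$ be a commutative ring and let $A$ and $B$ be persistence $R$-modules such that at least one of $A$, $B$ is $\varepsilon$-interleaved with $0$. Then $\operatorname{Tor}_i^R(A,B)\stackrel{\varepsilon}{\sim}0$ for all $i$.
   Context: Standing assumptions: one of the following holds. (1) $R$ is a Noetherian ring with unity, the index monoid is $I=\mathbb{Z}_{\geq 0}$, and persistence modules are of finite type (each component finitely generated, and the structure maps are isomorphisms from some index on). (2) $R$ is a ring with unity, the index monoid $I$ is good, and persistence modules are of finitely presented type (each component finitely presented, and the structure maps are isomorphisms from some index on). For a commutative monoid $(I,+)$ write $g_1\preceq g_2$ if $g_2=h+g_1$ for some $h\in I$. $I$ is good if it is commutative, cancellative, $\preceq$ is antisymmetric, and every finite $H\subseteq I$ has at most finitely many partially least common multiples, where a common multiple of $H$ is $m\in I$ with $h\preceq m$ for all $h\in H$, and it is partially least if no other common multiple $m_1$ of $H$ satisfies $m_1\preceq m$. A persistence $R$-module indexed by $I$ is a functor from the poset $(I,\preceq)$ to $R$-modules, i.e. modules $M_i$ with structure maps $M_i\to M_j$ for $i\preceq j$. The category $Fun(I,R\text{-}Mod)$ of these has enough projectives. The tensor product of persistence modules is taken componentwise over $R$, $(A\otimes B)_i=A_i\otimes_R B_i$, and $\operatorname{Tor}_i^R(A,B)$ denotes its left derived functors, computed by tensoring a projective resolution in $Fun(I,R\text{-}Mod)$ and taking homology. For $\varepsilon\in I$, an $\varepsilon$-morphism $M\to N$ is a family of homomorphisms $M_i\to N_{i+\varepsilon}$ commuting with structure maps; $\operatorname{Id}_\varepsilon: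 M\to M$ is the one given by structure maps $M_i\to M_{i+\varepsilon}$. $M\stackrel{\varepsilon}{\sim}N$ ($\varepsilon$-interleaved) means that there are $\varepsilon$-morphisms $\phi:M\to N$, $\psi:N\to M$ with $\phi\circ\psi=\operatorname{Id}_{2\varepsilon}$ and $\psi\circ\phi=\operatorname{Id}_{2\varepsilon}$. *)

theory Defs
  imports "HOL-Algebra.Module" "HOL-Algebra.Ring_Divisibility"
begin

section \<open>Modules over a commutative ring\<close>

definition mod_hom ::
  "('r, 'c) ring_scheme \<Rightarrow> ('r, 'm, 'd) module_scheme \<Rightarrow> ('r, 'n, 'e) module_scheme \<Rightarrow> ('m \<Rightarrow> 'n) set"
  where "mod_hom R M N = {f \<in> hom (add_monoid M) (add_monoid N).
    \<forall>r \<in> carrier R. \<forall>x \<in> carrier M. f (r \<odot>\<^bsub>M\<^esub> x) = r \<odot>\<^bsub>N\<^esub> f x}"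

definition gen_submodule ::
  "('r, 'c) ring_scheme \<Rightarrow> ('r, 'm, 'd) module_scheme \<Rightarrow> 'm set \<Rightarrow> 'm set"
  where "gen_submodule R M S = \<Inter> {H. submodule H R M \<and> S \<subseteq> H}"

text \<open>Records for modules extend those for rings; the multiplicative fields carry no meaning for a
  module and are left undefined below. The free module on \<open>S\<close> consists of the finitely supported
  functions on \<open>S\<close>, extended by zero.\<close>

definition free_mod :: "('r, 'c) ring_scheme \<Rightarrow> 's set \<Rightarrow> ('r, 's \<Rightarrow> 'r) module"
  where "free_mod R S =
    \<lparr>carrier = {x. (\<forall>s. x s \<in> carrier R) \<and> (\<forall>s. s \<notin> S \<longrightarrow> x s = \<zero>\<^bsub>R\<^esub>) \<and> finite {s. x s \<noteq> \<zero>\<^bsub>R\<^esub>}},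
     mult = undefined, one = undefined,
     zero = (\<lambda>s. \<zero>\<^bsub>R\<^esub>), add = (\<lambda>x y s. x s \<oplus>\<^bsub>R\<^esub> y s),
     smult = (\<lambda>r x s. r \<otimes>\<^bsub>R\<^esub> x s)\<rparr>"

definition basis_vec :: "('r, 'c) ring_scheme \<Rightarrow> 's \<Rightarrow> 's \<Rightarrow> 'r"
  where "basis_vec R s = (\<lambda>t. if t = s then \<one>\<^bsub>R\<^esub> else \<zero>\<^bsub>R\<^esub>)"

text \<open>The linear extension of a map \<open>h\<close> between bases.\<close>

definition free_map :: "('r, 'c) ring_scheme \<Rightarrow> ('s \<Rightarrow> 't) \<Rightarrow> ('s \<Rightarrow> 'r) \<Rightarrow> ('t \<Rightarrow> 'r)"
  where "free_map R h x = (\<lambda>t. \<Oplus>\<^bsub>R\<^esub> s \<in> {s. x s \<noteq> \<zero>\<^bsub>R\<^esub> \<and> h s = t}. x s)"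

text \<open>The map on cosets induced by \<open>f\<close>, into the cosets of \<open>L\<close> in \<open>N\<close>. Where \<open>f\<close> descends to the
  quotients, the union below is over equal cosets.\<close>

definition coset_map :: "('n, 'd) ring_scheme \<Rightarrow> 'n set \<Rightarrow> ('m \<Rightarrow> 'n) \<Rightarrow> 'm set \<Rightarrow> 'n set"
  where "coset_map N L f X = (\<Union>x \<in> X. L +>\<^bsub>N\<^esub> f x)"

definition quot_mod :: "('r, 'm, 'd) module_scheme \<Rightarrow> 'm set \<Rightarrow> ('r, 'm set) module"
  where "quot_mod M K =
    \<lparr>carrier = a_rcosets\<^bsub>M\<^esub> K, mult = undefined, one = undefined,
     zero = K, add = set_add M, smult = (\<lambda>r. coset_map M K (smult M r))\<rparr>"

definition fin_gen_module :: "('r, 'c) ring_scheme \<Rightarrow> ('r, 'm, 'd) module_scheme \<Rightarrow> bool"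
  where "fin_gen_module R M \<longleftrightarrow>
    (\<exists>S. finite S \<and> S \<subseteq> carrier M \<and> carrier M = gen_submodule R M S)"

definition fin_pres_module :: "('r, 'c) ring_scheme \<Rightarrow> ('r, 'm, 'd) module_scheme \<Rightarrow> bool"
  where "fin_pres_module R M \<longleftrightarrow>
    (\<exists>(n::nat) p S. p \<in> mod_hom R (free_mod R {..<n}) M
      \<and> p ` carrier (free_mod R {..<n}) = carrier M
      \<and> finite S \<and> S \<subseteq> carrier (free_mod R {..<n})
      \<and> a_kernel (free_mod R {..<n}) M p = gen_submodule R (free_mod R {..<n}) S)"

text \<open>Tensor product: the free module on pairs modulo the bilinearity relations.\<close>

definition tensor_free ::
  "('r, 'c) ring_scheme \<Rightarrow> ('r, 'm, 'd) module_scheme \<Rightarrow> ('r, 'n, 'e) module_scheme \<Rightarrow>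
    ('r, 'm \<times> 'n \<Rightarrow> 'r) module"
  where "tensor_free R M N = free_mod R (carrier M \<times> carrier N)"

definition tensor_rels ::
  "('r, 'c) ring_scheme \<Rightarrow> ('r, 'm, 'd) module_scheme \<Rightarrow> ('r, 'n, 'e) module_scheme \<Rightarrow>
    ('m \<times> 'n \<Rightarrow> 'r) set"
  where "tensor_rels R M N = (let F = tensor_free R M N; e = basis_vec R in
     {e (a \<oplus>\<^bsub>M\<^esub> a', b) \<ominus>\<^bsub>F\<^esub> (e (a, b) \<oplus>\<^bsub>F\<^esub> e (a', b)) | a a' b.
        a \<in> carrier M \<and> a' \<in> carrier M \<and> b \<in> carrier N}
   \<union> {e (a, b \<oplus>\<^bsub>N\<^esub> b') \<ominus>\<^bsub>F\<^esub> (e (a, b) \<oplus>\<^bsub>F\<^esub> e (a, b')) | a b b'.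
        a \<in> carrier M \<and> b \<in> carrier N \<and> b' \<in> carrier N}
   \<union> {e (r \<odot>\<^bsub>M\<^esub> a, b) \<ominus>\<^bsub>F\<^esub> r \<odot>\<^bsub>F\<^esub> e (a, b) | r a b.
        r \<in> carrier R \<and> a \<in> carrier M \<and> b \<in> carrier N}
   \<union> {e (a, r \<odot>\<^bsub>N\<^esub> b) \<ominus>\<^bsub>F\<^esub> r \<odot>\<^bsub>F\<^esub> e (a, b) | r a b.
        r \<in> carrier R \<and> a \<in> carrier M \<and> b \<in> carrier N})"

definition tensor_ker ::
  "('r, 'c) ring_scheme \<Rightarrow> ('r, 'm, 'd) module_scheme \<Rightarrow> ('r, 'n, 'e) module_scheme \<Rightarrow>
    ('m \<times> 'n \<Rightarrow> 'r) set"
  where "tensor_ker R M N = gen_submodule R (tensor_free R M N) (tensor_rels R M N)"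

definition tensor_mod ::
  "('r, 'c) ring_scheme \<Rightarrow> ('r, 'm, 'd) module_scheme \<Rightarrow> ('r, 'n, 'e) module_scheme \<Rightarrow>
    ('r, ('m \<times> 'n \<Rightarrow> 'r) set) module"
  where "tensor_mod R M N = quot_mod (tensor_free R M N) (tensor_ker R M N)"

text \<open>\<open>f \<otimes> g\<close> into the tensor product of \<open>M'\<close> and \<open>N'\<close>.\<close>

definition tensor_map ::
  "('r, 'c) ring_scheme \<Rightarrow> ('r, 'm', 'd) module_scheme \<Rightarrow> ('r, 'n', 'e) module_scheme \<Rightarrow>
    ('m \<Rightarrow> 'm') \<Rightarrow> ('n \<Rightarrow> 'n') \<Rightarrow> ('m \<times> 'n \<Rightarrow> 'r) set \<Rightarrow> ('m' \<times> 'n' \<Rightarrow> 'r) set"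
  where "tensor_map R M' N' f g =
    coset_map (tensor_free R M' N') (tensor_ker R M' N') (free_map R (map_prod f g))"


section \<open>Index monoids\<close>

text \<open>The index monoid is written multiplicatively, following the library: \<open>g \<otimes> h\<close> stands for
  \<open>g + h\<close> and \<open>\<one>\<close> for \<open>0\<close>.\<close>

definition mon_le :: "('i, 'k) monoid_scheme \<Rightarrow> 'i \<Rightarrow> 'i \<Rightarrow> bool"
  where "mon_le I g1 g2 \<longleftrightarrow> g1 \<in> carrier I \<and> g2 \<in> carrier I
    \<and> (\<exists>h \<in> carrier I. g2 = h \<otimes>\<^bsub>I\<^esub> g1)"

definition common_mult :: "('i, 'k) monoid_scheme \<Rightarrow> 'i set \<Rightarrow> 'i \<Rightarrow> bool"
  where "common_mult I H m \<longleftrightarrow> m \<in> carrier I \<and> (\<forall>h \<in> H. mon_le I h m)"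

definition partially_lcm :: "('i, 'k) monoid_scheme \<Rightarrow> 'i set \<Rightarrow> 'i \<Rightarrow> bool"
  where "partially_lcm I H m \<longleftrightarrow> common_mult I H m
    \<and> \<not> (\<exists>m1. common_mult I H m1 \<and> m1 \<noteq> m \<and> mon_le I m1 m)"

definition good_monoid :: "('i, 'k) monoid_scheme \<Rightarrow> bool"
  where "good_monoid I \<longleftrightarrow> comm_monoid I
    \<and> (\<forall>a \<in> carrier I. \<forall>b \<in> carrier I. \<forall>c \<in> carrier I. c \<otimes>\<^bsub>I\<^esub> a = c \<otimes>\<^bsub>I\<^esub> b \<longrightarrow> a = b)
    \<and> (\<forall>a b. mon_le I a b \<and> mon_le I b a \<longrightarrow> a = b)
    \<and> (\<forall>H. finite H \<and> H \<subseteq> carrier I \<longrightarrow> finite {m. partially_lcm I H m})"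

definition nat_add_monoid :: "nat monoid"
  where "nat_add_monoid = \<lparr>carrier = UNIV, mult = (+), one = 0\<rparr>"


section \<open>Persistence modules\<close>

record ('i, 'r, 'm) pmod =
  pcomp :: "'i \<Rightarrow> ('r, 'm) module"
  pmap :: "'i \<Rightarrow> 'i \<Rightarrow> 'm \<Rightarrow> 'm"

definition persistence_module ::
  "('r, 'c) ring_scheme \<Rightarrow> ('i, 'k) monoid_scheme \<Rightarrow> ('i, 'r, 'm) pmod \<Rightarrow> bool"
  where "persistence_module R I M \<longleftrightarrow>
      (\<forall>i \<in> carrier I. module R (pcomp M i))
    \<and> (\<forall>i j. mon_le I i j \<longrightarrow> pmap M i j \<in> mod_hom R (pcomp M i) (pcomp M j))
    \<and> (\<forall>i \<in> carrier I. \<forall>x \<in> carrier (pcomp M i). pmap M i i x = x)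
    \<and> (\<forall>i j k. mon_le I i j \<and> mon_le I j k \<longrightarrow>
          (\<forall>x \<in> carrier (pcomp M i). pmap M j k (pmap M i j x) = pmap M i k x))"

definition eventually_iso :: "('i, 'k) monoid_scheme \<Rightarrow> ('i, 'r, 'm) pmod \<Rightarrow> bool"
  where "eventually_iso I M \<longleftrightarrow> (\<exists>D \<in> carrier I. \<forall>i j. mon_le I D i \<and> mon_le I i j \<longrightarrow>
    bij_betw (pmap M i j) (carrier (pcomp M i)) (carrier (pcomp M j)))"

definition finite_type ::
  "('r, 'c) ring_scheme \<Rightarrow> ('i, 'k) monoid_scheme \<Rightarrow> ('i, 'r, 'm) pmod \<Rightarrow> bool"
  where "finite_type R I M \<longleftrightarrow> (\<forall>i \<in> carrier I. fin_gen_module R (pcomp M i)) \<and> eventually_iso I M"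

definition fin_pres_type ::
  "('r, 'c) ring_scheme \<Rightarrow> ('i, 'k) monoid_scheme \<Rightarrow> ('i, 'r, 'm) pmod \<Rightarrow> bool"
  where "fin_pres_type R I M \<longleftrightarrow> (\<forall>i \<in> carrier I. fin_pres_module R (pcomp M i)) \<and> eventually_iso I M"

definition zero_pmod :: "('i, 'r, unit) pmod"
  where "zero_pmod =
    \<lparr>pcomp = (\<lambda>_. \<lparr>carrier = {()}, mult = (\<lambda>_ _. ()), one = (), zero = (), add = (\<lambda>_ _. ()),
       smult = (\<lambda>_ _. ())\<rparr>),
     pmap = (\<lambda>_ _ _. ())\<rparr>"

definition pmod_hom ::
  "('r, 'c) ring_scheme \<Rightarrow> ('i, 'k) monoid_scheme \<Rightarrow> ('i, 'r, 'm) pmod \<Rightarrow> ('i, 'r, 'n) pmod \<Rightarrow>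
    ('i \<Rightarrow> 'm \<Rightarrow> 'n) set"
  where "pmod_hom R I M N = {f.
      (\<forall>i \<in> carrier I. f i \<in> mod_hom R (pcomp M i) (pcomp N i))
    \<and> (\<forall>i j. mon_le I i j \<longrightarrow>
        (\<forall>x \<in> carrier (pcomp M i). pmap N i j (f i x) = f j (pmap M i j x)))}"

definition pmod_surj ::
  "('i, 'k) monoid_scheme \<Rightarrow> ('i, 'r, 'm) pmod \<Rightarrow> ('i, 'r, 'n) pmod \<Rightarrow> ('i \<Rightarrow> 'm \<Rightarrow> 'n) \<Rightarrow> bool"
  where "pmod_surj I M N f \<longleftrightarrow>
    (\<forall>i \<in> carrier I. f i ` carrier (pcomp M i) = carrier (pcomp N i))"

definition eps_hom ::
  "('r, 'c) ring_scheme \<Rightarrow> ('i, 'k) monoid_scheme \<Rightarrow> 'i \<Rightarrow> ('i, 'r, 'm) pmod \<Rightarrow> ('i, 'r, 'n) pmod \<Rightarrow>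
    ('i \<Rightarrow> 'm \<Rightarrow> 'n) set"
  where "eps_hom R I \<epsilon> M N = {f.
      (\<forall>i \<in> carrier I. f i \<in> mod_hom R (pcomp M i) (pcomp N (i \<otimes>\<^bsub>I\<^esub> \<epsilon>)))
    \<and> (\<forall>i j. mon_le I i j \<longrightarrow>
        (\<forall>x \<in> carrier (pcomp M i).
           pmap N (i \<otimes>\<^bsub>I\<^esub> \<epsilon>) (j \<otimes>\<^bsub>I\<^esub> \<epsilon>) (f i x) = f j (pmap M i j x)))}"

definition interleaved ::
  "('r, 'c) ring_scheme \<Rightarrow> ('i, 'k) monoid_scheme \<Rightarrow> 'i \<Rightarrow> ('i, 'r, 'm) pmod \<Rightarrow> ('i, 'r, 'n) pmod \<Rightarrow>
    bool"
  where "interleaved R I \<epsilon> M N \<longleftrightarrow> (\<exists>\<phi> \<in> eps_hom R I \<epsilon> M N. \<exists>\<psi> \<in> eps_hom R I \<epsilon> N M.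
      (\<forall>i \<in> carrier I. \<forall>x \<in> carrier (pcomp M i).
         \<psi> (i \<otimes>\<^bsub>I\<^esub> \<epsilon>) (\<phi> i x) = pmap M i (i \<otimes>\<^bsub>I\<^esub> (\<epsilon> \<otimes>\<^bsub>I\<^esub> \<epsilon>)) x)
    \<and> (\<forall>i \<in> carrier I. \<forall>y \<in> carrier (pcomp N i).
         \<phi> (i \<otimes>\<^bsub>I\<^esub> \<epsilon>) (\<psi> i y) = pmap N i (i \<otimes>\<^bsub>I\<^esub> (\<epsilon> \<otimes>\<^bsub>I\<^esub> \<epsilon>)) y))"

definition ptensor ::
  "('r, 'c) ring_scheme \<Rightarrow> ('i, 'r, 'm) pmod \<Rightarrow> ('i, 'r, 'n) pmod \<Rightarrow>
    ('i, 'r, ('m \<times> 'n \<Rightarrow> 'r) set) pmod"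
  where "ptensor R M N =
    \<lparr>pcomp = (\<lambda>i. tensor_mod R (pcomp M i) (pcomp N i)),
     pmap = (\<lambda>i j. tensor_map R (pcomp M j) (pcomp N j) (pmap M i j) (pmap N i j))\<rparr>"


section \<open>Projective resolutions and Tor\<close>

text \<open>Projectivity is the lifting property against componentwise surjective (equivalently, epic)
  morphisms. HOL cannot quantify over types inside a definition, so the test objects live in types
  built from that of \<open>P\<close>. These are large enough: the canonical surjection onto \<open>P\<close> from the free
  persistence module on its elements, with component at \<open>j\<close> the free module on
  \<open>{(i, x). i \<preceq> j \<and> x \<in> P\<^sub>i}\<close>, is among the tests; lifting the identity along it makes \<open>P\<close>
  a retract of a free persistence module, which has the lifting property over all types.\<close>

definition projective_pmod ::
  "('r, 'c) ring_scheme \<Rightarrow> ('i, 'k) monoid_scheme \<Rightarrow> ('i, 'r, 'p) pmod \<Rightarrow> bool"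
  where "projective_pmod R I P \<longleftrightarrow> persistence_module R I P
    \<and> (\<forall>(X :: ('i, 'r, 'i \<times> 'p \<Rightarrow> 'r) pmod) (Y :: ('i, 'r, 'p) pmod) q f.
         persistence_module R I X \<and> persistence_module R I Y
         \<and> q \<in> pmod_hom R I X Y \<and> pmod_surj I X Y q \<and> f \<in> pmod_hom R I P Y
         \<longrightarrow> (\<exists>g \<in> pmod_hom R I P X. \<forall>i \<in> carrier I. \<forall>x \<in> carrier (pcomp P i).
                q i (g i x) = f i x))"

text \<open>A complex in nonnegative degrees is given by objects \<open>C n\<close> and differentials
  \<open>d n\<close> from \<open>C (Suc n)\<close> to \<open>C n\<close>.\<close>

definition cycles ::
  "(nat \<Rightarrow> ('i, 'r, 'm) pmod) \<Rightarrow> (nat \<Rightarrow> 'i \<Rightarrow> 'm \<Rightarrow> 'm) \<Rightarrow> nat \<Rightarrow> 'i \<Rightarrow> 'm set"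
  where "cycles C d n i = (case n of 0 \<Rightarrow> carrier (pcomp (C 0) i)
    | Suc k \<Rightarrow> a_kernel (pcomp (C (Suc k)) i) (pcomp (C k) i) (d k i))"

definition boundaries ::
  "(nat \<Rightarrow> ('i, 'r, 'm) pmod) \<Rightarrow> (nat \<Rightarrow> 'i \<Rightarrow> 'm \<Rightarrow> 'm) \<Rightarrow> nat \<Rightarrow> 'i \<Rightarrow> 'm set"
  where "boundaries C d n i = d n i ` carrier (pcomp (C (Suc n)) i)"

definition homology ::
  "(nat \<Rightarrow> ('i, 'r, 'm) pmod) \<Rightarrow> (nat \<Rightarrow> 'i \<Rightarrow> 'm \<Rightarrow> 'm) \<Rightarrow> nat \<Rightarrow> ('i, 'r, 'm set) pmod"
  where "homology C d n =
    \<lparr>pcomp = (\<lambda>i. quot_mod ((pcomp (C n) i)\<lparr>carrier := cycles C d n i\<rparr>) (boundaries C d n i)),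
     pmap = (\<lambda>i j. coset_map (pcomp (C n) j) (boundaries C d n j) (pmap (C n) i j))\<rparr>"

definition projective_resolution ::
  "('r, 'c) ring_scheme \<Rightarrow> ('i, 'k) monoid_scheme \<Rightarrow> ('i, 'r, 'm) pmod \<Rightarrow>
    (nat \<Rightarrow> ('i, 'r, 'p) pmod) \<Rightarrow> (nat \<Rightarrow> 'i \<Rightarrow> 'p \<Rightarrow> 'p) \<Rightarrow> ('i \<Rightarrow> 'p \<Rightarrow> 'm) \<Rightarrow> bool"
  where "projective_resolution R I A P d \<eta> \<longleftrightarrow>
      (\<forall>n. projective_pmod R I (P n))
    \<and> (\<forall>n. d n \<in> pmod_hom R I (P (Suc n)) (P n))
    \<and> \<eta> \<in> pmod_hom R I (P 0) A
    \<and> pmod_surj I (P 0) A \<eta>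
    \<and> (\<forall>i \<in> carrier I. boundaries P d 0 i = a_kernel (pcomp (P 0) i) (pcomp A i) (\<eta> i))
    \<and> (\<forall>n. \<forall>i \<in> carrier I. boundaries P d (Suc n) i = cycles P d (Suc n) i)"

text \<open>\<open>Tor\<^sub>n(A, B)\<close> computed from a projective resolution \<open>(P, d)\<close> of \<open>A\<close>: the homology of
  \<open>P \<otimes> B\<close> in degree \<open>n\<close>.\<close>

definition Tor ::
  "('r, 'c) ring_scheme \<Rightarrow> (nat \<Rightarrow> ('i, 'r, 'p) pmod) \<Rightarrow> (nat \<Rightarrow> 'i \<Rightarrow> 'p \<Rightarrow> 'p) \<Rightarrow>
    ('i, 'r, 'b) pmod \<Rightarrow> nat \<Rightarrow> ('i, 'r, ('p \<times> 'b \<Rightarrow> 'r) set set) pmod"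
  where "Tor R P d B n =
    homology (\<lambda>k. ptensor R (P k) B)
      (\<lambda>k i. tensor_map R (pcomp (P k) i) (pcomp B i) (d k i) (\<lambda>b. b)) n"

end

theory Submission
  imports Defs
begin

text \<open>A persistence module is \<open>\<epsilon>\<close>-interleaved with \<open>0\<close> iff all its structure maps from \<open>i\<close> to
  \<open>i + 2\<epsilon>\<close> vanish. If \<open>B\<close> has this property, so has every \<open>P\<^sub>n \<otimes> B\<close>, hence the homology. If \<open>A\<close>
  has it, fix \<open>i\<close>: the structure maps of the resolution form a chain map from \<open>P\<^sub>i\<close> to \<open>P\<^sub>i\<^sub>+\<^sub>2\<^sub>\<epsilon>\<close>
  lifting zero. The components of a projective persistence module are projective \<open>R\<close>-modules, as
  retracts of free ones, so this chain map is null-homotopic over \<open>R\<close>. Tensoring the homotopy with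
  the structure map of \<open>B\<close> shows that it induces zero on the homology of \<open>P \<otimes> B\<close>. The homotopy
  need not be natural in \<open>i\<close>.\<close>

section \<open>Homomorphisms of modules\<close>

text \<open>The two cases are asymmetric because \<open>Tor\<close> resolves \<open>A\<close> only.
  Vanishing on \<open>B\<close> passes to the tensor products directly; vanishing on
  \<open>A\<close> does not make the structure maps of the terms \<open>P n\<close> vanish, and
  survives there only up to homotopy. Fixing both indices keeps the homotopy inside module theory:
  no shifted persistence module has to be formed. The obstacle is the lifting step.
  \<open>projective_pmod\<close> tests only surjections whose source lives over
  \<open>'i \<times> 'p \<Rightarrow> 'r\<close>, while the differentials to be lifted against have
  their source over \<open>'p\<close>. The lifting property is therefore applied only to the
  identity of \<open>P\<close> and the canonical free cover; the section so obtained reduces every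
  other lifting problem to a choice of preimages of basis values. Lifting is then phrased for maps
  with values in an image, not for surjections, so that the image of a differential need not first
  be made into a module.\<close>

lemma mod_homI:
  assumes "\<And>x. x \<in> carrier M \<Longrightarrow> f x \<in> carrier N"
    and "\<And>x y. x \<in> carrier M \<Longrightarrow> y \<in> carrier M \<Longrightarrow> f (x \<oplus>\<^bsub>M\<^esub> y) = f x \<oplus>\<^bsub>N\<^esub> f y"
    and "\<And>r x. r \<in> carrier R \<Longrightarrow> x \<in> carrier M \<Longrightarrow> f (r \<odot>\<^bsub>M\<^esub> x) = r \<odot>\<^bsub>N\<^esub> f x"
  shows "f \<in> mod_hom R M N"
  using assms by (auto simp: mod_hom_def hom_def)

lemma mod_homD:
  assumes "f \<in> mod_hom R M N"
  shows mod_hom_closed: "x \<in> carrier M \<Longrightarrow> f x \<in> carrier N"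
    and mod_hom_add: "x \<in> carrier M \<Longrightarrow> y \<in> carrier M \<Longrightarrow> f (x \<oplus>\<^bsub>M\<^esub> y) = f x \<oplus>\<^bsub>N\<^esub> f y"
    and mod_hom_smult: "r \<in> carrier R \<Longrightarrow> x \<in> carrier M \<Longrightarrow> f (r \<odot>\<^bsub>M\<^esub> x) = r \<odot>\<^bsub>N\<^esub> f x"
  using assms by (auto simp: mod_hom_def hom_def)

lemma mod_hom_zero:
  assumes "module R M" "module R N" "f \<in> mod_hom R M N"
  shows "f \<zero>\<^bsub>M\<^esub> = \<zero>\<^bsub>N\<^esub>"
proof -
  interpret M: module R M by fact
  interpret N: module R N by fact
  have "f \<zero>\<^bsub>M\<^esub> = f (\<zero>\<^bsub>R\<^esub> \<odot>\<^bsub>M\<^esub> \<zero>\<^bsub>M\<^esub>)" by simp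
  also have "\<dots> = \<zero>\<^bsub>N\<^esub>"
    using mod_homD[OF assms(3)] by (metis M.zero_closed M.R.zero_closed N.smult_l_null)
  finally show ?thesis .
qed

lemma mod_hom_uminus:
  assumes "module R M" "module R N" "f \<in> mod_hom R M N" "x \<in> carrier M"
  shows "f (\<ominus>\<^bsub>M\<^esub> x) = \<ominus>\<^bsub>N\<^esub> f x"
proof -
  interpret M: module R M by fact
  interpret N: module R N by fact
  show ?thesis
    using mod_homD[OF assms(3)] assms(4) mod_hom_zero[OF assms(1-3)]
    by (metis M.a_inv_closed M.l_neg N.minus_equality)
qed

lemma mod_hom_minus:
  assumes "module R M" "module R N" "f \<in> mod_hom R M N" "x \<in> carrier M" "y \<in> carrier M"
  shows "f (x \<ominus>\<^bsub>M\<^esub> y) = f x \<ominus>\<^bsub>N\<^esub> f y"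
proof -
  interpret M: module R M by fact
  show ?thesis
    using assms by (simp add: a_minus_def mod_hom_uminus mod_hom_add)
qed

lemma mod_hom_comp:
  assumes "f \<in> mod_hom R M N" "g \<in> mod_hom R N L"
  shows "(\<lambda>x. g (f x)) \<in> mod_hom R M L"
  using mod_homD[OF assms(1)] mod_homD[OF assms(2)] by (intro mod_homI) auto

lemma mod_hom_cong:
  assumes "f \<in> mod_hom R M N" "\<And>x. x \<in> carrier M \<Longrightarrow> g x = f x" "module R M"
  shows "g \<in> mod_hom R M N"
proof -
  interpret M: module R M by fact
  show ?thesis using mod_homD[OF assms(1)] assms(2) by (intro mod_homI) auto
qed

lemma mod_hom_plus:
  assumes "module R N" "f \<in> mod_hom R M N" "g \<in> mod_hom R M N"
  shows "(\<lambda>x. f x \<oplus>\<^bsub>N\<^esub> g x) \<in> mod_hom R M N"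
proof -
  interpret N: module R N by fact
  show ?thesis
    using mod_homD[OF assms(2)] mod_homD[OF assms(3)]
    by (intro mod_homI) (auto simp: N.a_ac N.smult_r_distr)
qed

lemma mod_hom_uminus_fun:
  assumes "module R N" "f \<in> mod_hom R M N"
  shows "(\<lambda>x. \<ominus>\<^bsub>N\<^esub> f x) \<in> mod_hom R M N"
proof -
  interpret N: module R N by fact
  show ?thesis
    using mod_homD[OF assms(2)]
    by (intro mod_homI) (auto simp: N.minus_add N.smult_r_minus)
qed

lemma mod_hom_diff:
  assumes "module R N" "f \<in> mod_hom R M N" "g \<in> mod_hom R M N"
  shows "(\<lambda>x. f x \<ominus>\<^bsub>N\<^esub> g x) \<in> mod_hom R M N"
  unfolding a_minus_def by (intro mod_hom_plus mod_hom_uminus_fun assms)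

lemma mod_hom_const_zero:
  assumes "module R N"
  shows "(\<lambda>x. \<zero>\<^bsub>N\<^esub>) \<in> mod_hom R M N"
proof -
  interpret N: module R N by fact
  show ?thesis by (intro mod_homI) auto
qed

lemma mod_hom_smult_fun:
  assumes "module R M" "r \<in> carrier R"
  shows "(\<odot>\<^bsub>M\<^esub>) r \<in> mod_hom R M M"
proof -
  interpret M: module R M by fact
  show ?thesis
    using assms(2) by (intro mod_homI) (auto simp: M.smult_r_distr M.smult_assoc1[symmetric] M.R.m_comm)
qed

lemma mod_hom_id: "(\<lambda>x. x) \<in> mod_hom R M M"
  by (intro mod_homI) auto

section \<open>Submodules obtained from homomorphisms, and generated submodules\<close>

lemma a_kernel_eq: "a_kernel M N f = {x \<in> carrier M. f x = \<zero>\<^bsub>N\<^esub>}"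
  by (auto simp: a_kernel_def kernel_def)

lemma submodule_kernel:
  assumes "module R M" "module R N" "f \<in> mod_hom R M N"
  shows "submodule (a_kernel M N f) R M"
proof -
  interpret M: module R M by fact
  interpret N: module R N by fact
  show ?thesis
    using mod_homD[OF assms(3)] mod_hom_zero[OF assms] mod_hom_uminus[OF assms]
    by (intro M.submoduleI) (auto simp: a_kernel_eq)
qed

lemma submodule_image:
  assumes "module R M" "module R N" "f \<in> mod_hom R M N"
  shows "submodule (f ` carrier M) R N"
proof -
  interpret M: module R M by fact
  interpret N: module R N by fact
  show ?thesis
  proof (rule N.submoduleI)
    show "f ` carrier M \<subseteq> carrier N"
      using mod_hom_closed[OF assms(3)] by blast
    show "\<zero>\<^bsub>N\<^esub> \<in> f ` carrier M"
      using mod_hom_zero[OF assms, symmetric] M.zero_closed by (rule image_eqI)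
    show "\<ominus>\<^bsub>N\<^esub> a \<in> f ` carrier M" if "a \<in> f ` carrier M" for a
      using that by (auto simp: mod_hom_uminus[OF assms, symmetric])
    show "a \<oplus>\<^bsub>N\<^esub> b \<in> f ` carrier M" if "a \<in> f ` carrier M" "b \<in> f ` carrier M" for a b
      using that by (auto simp: mod_hom_add[OF assms(3), symmetric])
    show "r \<odot>\<^bsub>N\<^esub> a \<in> f ` carrier M" if "r \<in> carrier R" "a \<in> f ` carrier M" for r a
      using that by (auto simp: mod_hom_smult[OF assms(3), symmetric])
  qed
qed

text \<open>Serves to bound generated submodules: once the generators lie in this preimage,
  everything they generate does.\<close>

lemma submodule_preimage:
  assumes "module R M" "module R N" "f \<in> mod_hom R M N" "submodule L R N"
  shows "submodule {x \<in> carrier M. f x \<in> L} R M"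
proof -
  interpret M: module R M by fact
  interpret N: module R N by fact
  note L = N.submoduleE[OF assms(4)]
  have "\<zero>\<^bsub>N\<^esub> \<in> L"
    using subgroup.one_closed[OF submodule.axioms(1)[OF assms(4)]] by simp
  then show ?thesis
    using mod_homD[OF assms(3)] mod_hom_zero[OF assms(1-3)] mod_hom_uminus[OF assms(1-3)] L
    by (intro M.submoduleI) auto
qed

text \<open>The source of all extensionality arguments below: linear maps that agree on generators
  agree on a submodule containing them.\<close>

lemma mod_hom_equalizer:
  assumes "module R M" "module R N" "f \<in> mod_hom R M N" "g \<in> mod_hom R M N"
  shows "submodule {x \<in> carrier M. f x = g x} R M"
proof -
  interpret M: module R M by fact
  interpret N: module R N by fact
  show ?thesis
    using mod_homD[OF assms(3)] mod_hom_zero[OF assms(1-3)] mod_hom_uminus[OF assms(1-3)]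
      mod_homD[OF assms(4)] mod_hom_zero[OF assms(1,2,4)] mod_hom_uminus[OF assms(1,2,4)]
    by (intro M.submoduleI) auto
qed

lemma gen_submodule_submodule:
  assumes "module R M" "S \<subseteq> carrier M"
  shows "submodule (gen_submodule R M S) R M"
proof -
  interpret M: module R M by fact
  \<comment> \<open>The family is nonempty; otherwise its intersection would be the whole type and
    leave \<open>carrier M\<close>.\<close>
  have ne: "carrier M \<in> {H. submodule H R M \<and> S \<subseteq> H}"
    using M.carrier_is_submodule assms(2) by simp
  have zero: "\<zero>\<^bsub>M\<^esub> \<in> H" if "submodule H R M" for H
    using subgroup.one_closed[OF submodule.axioms(1)[OF that]] by simp
  show ?thesis
    unfolding gen_submodule_def
    by (rule M.submoduleI)
      (use ne in blast, auto simp: M.submoduleE zero)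
qed

lemma gen_submodule_subset: "S \<subseteq> gen_submodule R M S"
  by (auto simp: gen_submodule_def)

lemma gen_submodule_minimal:
  assumes "submodule H R M" "S \<subseteq> H"
  shows "gen_submodule R M S \<subseteq> H"
  using assms by (auto simp: gen_submodule_def)

text \<open>Homology is formed in two stages, restricting the carrier to the cycles and then
  dividing by the boundaries. This provides the second stage with a submodule of the restricted
  record.\<close>

lemma submodule_restrict:
  assumes "module R M" "submodule Z R M" "submodule K R M" "K \<subseteq> Z"
  shows "submodule K R (M\<lparr>carrier := Z\<rparr>)"
proof -
  interpret M: module R M by fact
  interpret Z: module R "M\<lparr>carrier := Z\<rparr>"
    by (rule submodule.submodule_is_module[OF assms(2,1)])
  show ?thesis
    using M.submoduleE[OF assms(3)] submodule.submodule_is_module[OF assms(3,1)] assms(4)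
    by (intro Z.module_incl_imp_submodule) simp_all
qed

section \<open>Quotients\<close>

lemma submodule_abelian_subgroup:
  assumes "module R M" "submodule K R M"
  shows "abelian_subgroup K M"
  using assms
  by (intro abelian_subgroupI3 additive_subgroupI) (auto simp: module_def submodule_def)

lemma a_r_cosetE:
  assumes "y \<in> K +>\<^bsub>M\<^esub> x"
  obtains k where "k \<in> K" "y = k \<oplus>\<^bsub>M\<^esub> x"
  using assms by (auto simp: a_r_coset_def r_coset_def)

text \<open>Cosets depend on the addition alone, so the class of a cycle is the same set among the
  cycles and among all chains.\<close>

lemma a_r_coset_restrict: "K +>\<^bsub>M\<lparr>carrier := Z\<rparr>\<^esub> x = K +>\<^bsub>M\<^esub> x"
  by (simp add: a_r_coset_def r_coset_def)

text \<open>The union in \<open>coset_map\<close> ranges over equal sets: two representatives differ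
  by some \<open>k\<close> in \<open>K\<close>, and \<open>f k\<close> is absorbed by
  \<open>L\<close>.\<close>

lemma coset_map_coset:
  assumes "module R M" "module R N" "submodule K R M" "submodule L R N"
    and "f \<in> mod_hom R M N" "f ` K \<subseteq> L" "x \<in> carrier M"
  shows "coset_map N L f (K +>\<^bsub>M\<^esub> x) = L +>\<^bsub>N\<^esub> f x"
proof -
  interpret M: module R M by fact
  interpret N: module R N by fact
  interpret K: abelian_subgroup K M by (rule submodule_abelian_subgroup) fact+
  interpret L: abelian_subgroup L N by (rule submodule_abelian_subgroup) fact+
  have "L +>\<^bsub>N\<^esub> f y = L +>\<^bsub>N\<^esub> f x" if y: "y \<in> K +>\<^bsub>M\<^esub> x" for y
  proof -
    obtain k where k: "k \<in> K" "y = k \<oplus>\<^bsub>M\<^esub> x"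
      using y by (rule a_r_cosetE)
    then have "f y = f k \<oplus>\<^bsub>N\<^esub> f x" "f k \<in> L" "f x \<in> carrier N"
      using mod_homD[OF assms(5)] assms(6,7) K.a_subset by auto
    then show ?thesis
      by (metis N.a_rcosI N.a_repr_independence L.a_subset L.a_subgroup)
  qed
  moreover have "x \<in> K +>\<^bsub>M\<^esub> x"
    using assms(7) by (metis K.a_rcos_self)
  ultimately show ?thesis
    unfolding coset_map_def by blast
qed

lemma quot_mod_simps:
  "carrier (quot_mod M K) = a_rcosets\<^bsub>M\<^esub> K" "\<zero>\<^bsub>quot_mod M K\<^esub> = K"
  "X \<oplus>\<^bsub>quot_mod M K\<^esub> Y = X <+>\<^bsub>M\<^esub> Y" "r \<odot>\<^bsub>quot_mod M K\<^esub> X = coset_map M K (smult M r) X"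
  by (simp_all add: quot_mod_def)

lemma quot_modE:
  assumes "X \<in> carrier (quot_mod M K)"
  obtains x where "x \<in> carrier M" "X = K +>\<^bsub>M\<^esub> x"
  using assms by (auto simp: quot_mod_simps A_RCOSETS_def')

text \<open>Reduces all work in quotients to representatives. Scalars act through
  \<open>coset_map\<close>, so their rule is an instance of \<open>coset_map_coset\<close>, applied
  to multiplication by \<open>r\<close>; that map is linear because the ring is commutative.\<close>

lemma quot_mod_coset:
  assumes "module R M" "submodule K R M"
  shows quot_mod_coset_closed: "x \<in> carrier M \<Longrightarrow> K +>\<^bsub>M\<^esub> x \<in> carrier (quot_mod M K)"
    and quot_mod_coset_add: "x \<in> carrier M \<Longrightarrow> y \<in> carrier M \<Longrightarrow>
      (K +>\<^bsub>M\<^esub> x) \<oplus>\<^bsub>quot_mod M K\<^esub> (K +>\<^bsub>M\<^esub> y) = K +>\<^bsub>M\<^esub> (x \<oplus>\<^bsub>M\<^esub> y)"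
    and quot_mod_coset_smult: "r \<in> carrier R \<Longrightarrow> x \<in> carrier M \<Longrightarrow>
      r \<odot>\<^bsub>quot_mod M K\<^esub> (K +>\<^bsub>M\<^esub> x) = K +>\<^bsub>M\<^esub> (r \<odot>\<^bsub>M\<^esub> x)"
    and quot_mod_coset_zero: "\<zero>\<^bsub>quot_mod M K\<^esub> = K +>\<^bsub>M\<^esub> \<zero>\<^bsub>M\<^esub>"
    and quot_mod_coset_eq_zero: "x \<in> K \<Longrightarrow> K +>\<^bsub>M\<^esub> x = \<zero>\<^bsub>quot_mod M K\<^esub>"
proof -
  interpret M: module R M by fact
  interpret K: abelian_subgroup K M by (rule submodule_abelian_subgroup) fact+
  show "x \<in> carrier M \<Longrightarrow> K +>\<^bsub>M\<^esub> x \<in> carrier (quot_mod M K)"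
    by (auto simp: quot_mod_simps A_RCOSETS_def')
  show "x \<in> carrier M \<Longrightarrow> y \<in> carrier M \<Longrightarrow>
      (K +>\<^bsub>M\<^esub> x) \<oplus>\<^bsub>quot_mod M K\<^esub> (K +>\<^bsub>M\<^esub> y) = K +>\<^bsub>M\<^esub> (x \<oplus>\<^bsub>M\<^esub> y)"
    by (simp add: quot_mod_simps K.a_rcos_sum)
  show "r \<in> carrier R \<Longrightarrow> x \<in> carrier M \<Longrightarrow>
      r \<odot>\<^bsub>quot_mod M K\<^esub> (K +>\<^bsub>M\<^esub> x) = K +>\<^bsub>M\<^esub> (r \<odot>\<^bsub>M\<^esub> x)"
    unfolding quot_mod_simps
    by (rule coset_map_coset[OF assms(1,1,2,2)])
      (auto intro: mod_hom_smult_fun assms M.submoduleE[OF assms(2)])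
  show "\<zero>\<^bsub>quot_mod M K\<^esub> = K +>\<^bsub>M\<^esub> \<zero>\<^bsub>M\<^esub>"
    by (simp add: quot_mod_simps K.a_subset)
  show "x \<in> K \<Longrightarrow> K +>\<^bsub>M\<^esub> x = \<zero>\<^bsub>quot_mod M K\<^esub>"
    using M.a_coset_join2 K.a_subgroup K.a_subset by (auto simp: quot_mod_simps)
qed

lemma quot_mod_proj:
  assumes "module R M" "submodule K R M"
  shows "(\<lambda>x. K +>\<^bsub>M\<^esub> x) \<in> mod_hom R M (quot_mod M K)"
  by (intro mod_homI) (simp_all add: quot_mod_coset[OF assms])

lemma module_quot_mod:
  assumes "module R M" "submodule K R M"
  shows "module R (quot_mod M K)"
proof -
  interpret M: module R M by fact
  note q = quot_mod_coset[OF assms]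
  have "abelian_group (quot_mod M K)"
  proof (rule abelian_groupI)
    fix X assume "X \<in> carrier (quot_mod M K)"
    then obtain x where x: "x \<in> carrier M" "X = K +>\<^bsub>M\<^esub> x" by (rule quot_modE)
    then have "(K +>\<^bsub>M\<^esub> (\<ominus>\<^bsub>M\<^esub> x)) \<oplus>\<^bsub>quot_mod M K\<^esub> X = \<zero>\<^bsub>quot_mod M K\<^esub>"
      by (simp add: q M.l_neg)
    with x show "\<exists>Y\<in>carrier (quot_mod M K). Y \<oplus>\<^bsub>quot_mod M K\<^esub> X = \<zero>\<^bsub>quot_mod M K\<^esub>"
      using q(1) by blast
  qed (auto elim!: quot_modE simp: q M.a_ac)
  then show ?thesis
    by (intro moduleI M.R.is_cring)
      (auto elim!: quot_modE simp: q M.smult_l_distr M.smult_r_distr M.smult_assoc1)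
qed

lemma coset_map_hom:
  assumes "module R M" "module R N" "submodule K R M" "submodule L R N"
    and "f \<in> mod_hom R M N" "f ` K \<subseteq> L"
  shows "coset_map N L f \<in> mod_hom R (quot_mod M K) (quot_mod N L)"
proof -
  interpret M: module R M by fact
  interpret N: module R N by fact
  show ?thesis
    using mod_homD[OF assms(5)]
    by (intro mod_homI)
      (auto elim!: quot_modE simp: coset_map_coset[OF assms] quot_mod_coset[OF assms(1,3)]
        quot_mod_coset[OF assms(2,4)])
qed

lemma coset_eqI:
  assumes "module R M" "submodule K R M" "x \<in> carrier M" "y \<in> carrier M" "x \<ominus>\<^bsub>M\<^esub> y \<in> K"
  shows "K +>\<^bsub>M\<^esub> x = K +>\<^bsub>M\<^esub> y"
proof -
  interpret M: module R M by fact
  interpret K: abelian_subgroup K M by (rule submodule_abelian_subgroup) fact+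
  have "x = (x \<ominus>\<^bsub>M\<^esub> y) \<oplus>\<^bsub>M\<^esub> y"
    using assms(3,4) by (simp add: a_minus_def M.a_assoc M.l_neg)
  then have "x \<in> K +>\<^bsub>M\<^esub> y"
    using M.a_rcosI[OF assms(5) K.a_subset assms(4)] by simp
  then show ?thesis
    using M.a_repr_independence[OF _ assms(4) K.a_subgroup] by simp
qed

section \<open>Free modules\<close>

lemma free_mod_simps:
  "carrier (free_mod R S) = {x. (\<forall>s. x s \<in> carrier R) \<and> (\<forall>s. s \<notin> S \<longrightarrow> x s = \<zero>\<^bsub>R\<^esub>)
     \<and> finite {s. x s \<noteq> \<zero>\<^bsub>R\<^esub>}}"
  "\<zero>\<^bsub>free_mod R S\<^esub> = (\<lambda>s. \<zero>\<^bsub>R\<^esub>)"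
  "x \<oplus>\<^bsub>free_mod R S\<^esub> y = (\<lambda>s. x s \<oplus>\<^bsub>R\<^esub> y s)"
  "r \<odot>\<^bsub>free_mod R S\<^esub> x = (\<lambda>s. r \<otimes>\<^bsub>R\<^esub> x s)"
  by (simp_all add: free_mod_def)

lemma module_free_mod:
  assumes "cring R"
  shows "module R (free_mod R S)"
proof -
  interpret R: cring R by fact
  have add: "x \<oplus>\<^bsub>free_mod R S\<^esub> y \<in> carrier (free_mod R S)"
    if "x \<in> carrier (free_mod R S)" "y \<in> carrier (free_mod R S)" for x y
  proof -
    have "{s. x s \<oplus>\<^bsub>R\<^esub> y s \<noteq> \<zero>\<^bsub>R\<^esub>} \<subseteq> {s. x s \<noteq> \<zero>\<^bsub>R\<^esub>} \<union> {s. y s \<noteq> \<zero>\<^bsub>R\<^esub>}" by auto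
    with that show ?thesis by (auto simp: free_mod_simps intro: finite_subset)
  qed
  have smult: "r \<odot>\<^bsub>free_mod R S\<^esub> x \<in> carrier (free_mod R S)"
    if "r \<in> carrier R" "x \<in> carrier (free_mod R S)" for r x
  proof -
    have "{s. r \<otimes>\<^bsub>R\<^esub> x s \<noteq> \<zero>\<^bsub>R\<^esub>} \<subseteq> {s. x s \<noteq> \<zero>\<^bsub>R\<^esub>}" using that by auto
    with that show ?thesis by (auto simp: free_mod_simps intro: finite_subset)
  qed
  have neg: "\<exists>y\<in>carrier (free_mod R S). y \<oplus>\<^bsub>free_mod R S\<^esub> x = \<zero>\<^bsub>free_mod R S\<^esub>"
    if "x \<in> carrier (free_mod R S)" for x
    using smult[OF R.a_inv_closed[OF R.one_closed] that] that
    \<comment> \<open>The inverse is taken as the multiple by minus one, so that its finite support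
      comes from \<open>smult\<close>.\<close>
    by (intro bexI[of _ "(\<ominus>\<^bsub>R\<^esub> \<one>\<^bsub>R\<^esub>) \<odot>\<^bsub>free_mod R S\<^esub> x"])
      (auto simp: free_mod_simps R.l_minus R.l_neg)
  have "abelian_group (free_mod R S)"
    by (rule abelian_groupI)
      (use add neg in \<open>auto simp: free_mod_simps R.a_ac\<close>)
  then show ?thesis
    by (intro moduleI assms smult)
      (auto simp: free_mod_simps R.l_distr R.r_distr R.m_assoc)
qed

lemma basis_vec_closed:
  assumes "cring R" "s \<in> S"
  shows "basis_vec R s \<in> carrier (free_mod R S)"
proof -
  interpret R: cring R by fact
  have "{t. basis_vec R s t \<noteq> \<zero>\<^bsub>R\<^esub>} \<subseteq> {s}" by (auto simp: basis_vec_def)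
  with assms show ?thesis
    by (auto simp: free_mod_simps basis_vec_def intro: finite_subset)
qed

text \<open>Induction on a finite set \<open>U\<close> bounding the support: clearing one coordinate
  of \<open>x\<close> changes it by a multiple of a basis vector and leaves a function supported in
  the smaller set.\<close>

lemma free_mod_span:
  assumes "cring R" "submodule H R (free_mod R S)" "\<And>s. s \<in> S \<Longrightarrow> basis_vec R s \<in> H"
    and "x \<in> carrier (free_mod R S)"
  shows "x \<in> H"
proof -
  interpret R: cring R by fact
  interpret F: module R "free_mod R S" by (rule module_free_mod) fact
  note H = F.submoduleE[OF assms(2)]
  have "\<zero>\<^bsub>free_mod R S\<^esub> \<in> H"
    using subgroup.one_closed[OF submodule.axioms(1)[OF assms(2)]] by simp
  have "x \<in> H" if "finite U" "x \<in> carrier (free_mod R S)" "{s. x s \<noteq> \<zero>\<^bsub>R\<^esub>} \<subseteq> U" for U x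
    using that
  proof (induction U arbitrary: x)
    case empty
    then have "x = \<zero>\<^bsub>free_mod R S\<^esub>" by (auto simp: free_mod_simps)
    then show ?case using \<open>\<zero>\<^bsub>free_mod R S\<^esub> \<in> H\<close> by simp
  next
    case (insert u U)
    let ?y = "\<lambda>t. if t = u then \<zero>\<^bsub>R\<^esub> else x t"
    have "{s. ?y s \<noteq> \<zero>\<^bsub>R\<^esub>} \<subseteq> {s. x s \<noteq> \<zero>\<^bsub>R\<^esub>}" by auto
    then have "?y \<in> carrier (free_mod R S)"
      using insert.prems(1) by (auto simp: free_mod_simps intro: finite_subset)
    then have y: "?y \<in> H"
      using insert.prems by (intro insert.IH) auto
    show ?case
    proof (cases "u \<in> S")
      case True
      have "x = ?y \<oplus>\<^bsub>free_mod R S\<^esub> (x u \<odot>\<^bsub>free_mod R S\<^esub> basis_vec R u)"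
        using insert.prems(1) by (auto simp: free_mod_simps basis_vec_def fun_eq_iff)
      moreover have "x u \<in> carrier R"
        using insert.prems(1) by (auto simp: free_mod_simps)
      ultimately show ?thesis
        using H(4,5) y assms(3)[OF True] by metis
    next
      \<comment> \<open>\<open>U\<close> merely bounds the support and may leave \<open>S\<close>;
        outside \<open>S\<close> the coordinate is already zero.\<close>
      case False
      then have "x = ?y" using insert.prems(1) by (auto simp: free_mod_simps fun_eq_iff)
      with y show ?thesis by simp
    qed
  qed
  then show ?thesis using assms(4) by (auto simp: free_mod_simps)
qed

lemma free_mod_hom_ext:
  assumes "cring R" "module R N" "f \<in> mod_hom R (free_mod R S) N" "g \<in> mod_hom R (free_mod R S) N"
    and "\<And>s. s \<in> S \<Longrightarrow> f (basis_vec R s) = g (basis_vec R s)" "x \<in> carrier (free_mod R S)"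
  shows "f x = g x"
proof -
  have "x \<in> {x \<in> carrier (free_mod R S). f x = g x}"
    by (rule free_mod_span[OF assms(1) mod_hom_equalizer[OF module_free_mod[OF assms(1)] assms(2-4)] _ assms(6)])
      (auto simp: assms(5) basis_vec_closed[OF assms(1)])
  then show ?thesis by simp
qed

section \<open>The universal property of free modules\<close>

definition free_lift ::
  "('r, 'c) ring_scheme \<Rightarrow> ('r, 'm, 'd) module_scheme \<Rightarrow> ('s \<Rightarrow> 'm) \<Rightarrow> ('s \<Rightarrow> 'r) \<Rightarrow> 'm"
  where "free_lift R M t x = (\<Oplus>\<^bsub>M\<^esub> s \<in> {s. x s \<noteq> \<zero>\<^bsub>R\<^esub>}. x s \<odot>\<^bsub>M\<^esub> t s)"

text \<open>The supports of \<open>x\<close>, \<open>y\<close> and their sum differ, so linearity is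
  checked over one common finite set; the added terms have coefficient zero. \<open>U\<close> stays
  inside \<open>S\<close> because only there is \<open>t\<close> known to take values in
  \<open>M\<close>.\<close>

lemma free_lift_superset:
  assumes "module R M" "x \<in> carrier (free_mod R S)" "t \<in> S \<rightarrow> carrier M"
    and "finite U" "U \<subseteq> S" "{s. x s \<noteq> \<zero>\<^bsub>R\<^esub>} \<subseteq> U"
  shows "free_lift R M t x = (\<Oplus>\<^bsub>M\<^esub> s \<in> U. x s \<odot>\<^bsub>M\<^esub> t s)"
proof -
  interpret M: module R M by fact
  show ?thesis
    unfolding free_lift_def
    using assms(2-6)
    by (intro M.add.finprod_mono_neutral_cong_left) (auto simp: free_mod_simps Pi_iff subset_iff)
qed

lemma free_lift_hom:
  assumes "module R M" "t \<in> S \<rightarrow> carrier M"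
  shows "free_lift R M t \<in> mod_hom R (free_mod R S) M"
proof -
  interpret M: module R M by fact
  interpret F: module R "free_mod R S" by (rule module_free_mod) (rule M.R.is_cring)
  have supp: "finite {s. x s \<noteq> \<zero>\<^bsub>R\<^esub>}" "{s. x s \<noteq> \<zero>\<^bsub>R\<^esub>} \<subseteq> S" "\<And>s. x s \<in> carrier R"
    if "x \<in> carrier (free_mod R S)" for x
    using that by (auto simp: free_mod_simps)
  have t: "t s \<in> carrier M" if "s \<in> S" for s using that assms(2) by auto
  show ?thesis
  proof (rule mod_homI)
    fix x assume x: "x \<in> carrier (free_mod R S)"
    show "free_lift R M t x \<in> carrier M"
      unfolding free_lift_def using supp[OF x] t by (intro M.finsum_closed) auto
  next
    fix x y assume x: "x \<in> carrier (free_mod R S)" and y: "y \<in> carrier (free_mod R S)"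
    let ?U = "{s. x s \<noteq> \<zero>\<^bsub>R\<^esub>} \<union> {s. y s \<noteq> \<zero>\<^bsub>R\<^esub>}"
    have U: "finite ?U" "?U \<subseteq> S" using supp[OF x] supp[OF y] by auto
    have "free_lift R M t (x \<oplus>\<^bsub>free_mod R S\<^esub> y)
        = (\<Oplus>\<^bsub>M\<^esub> s \<in> ?U. (x \<oplus>\<^bsub>free_mod R S\<^esub> y) s \<odot>\<^bsub>M\<^esub> t s)"
      using F.M.a_closed[OF x y] U
      by (intro free_lift_superset[OF assms(1) _ assms(2)]) (auto simp: free_mod_simps(3))
    also have "\<dots> = (\<Oplus>\<^bsub>M\<^esub> s \<in> ?U. x s \<odot>\<^bsub>M\<^esub> t s \<oplus>\<^bsub>M\<^esub> y s \<odot>\<^bsub>M\<^esub> t s)"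
      using U(2) t supp(3)[OF x] supp(3)[OF y]
      by (intro M.finsum_cong') (auto simp: free_mod_simps(3) subset_iff M.smult_l_distr)
    also have "\<dots> = (\<Oplus>\<^bsub>M\<^esub> s \<in> ?U. x s \<odot>\<^bsub>M\<^esub> t s) \<oplus>\<^bsub>M\<^esub> (\<Oplus>\<^bsub>M\<^esub> s \<in> ?U. y s \<odot>\<^bsub>M\<^esub> t s)"
      using U(2) t supp(3)[OF x] supp(3)[OF y] by (intro M.finsum_addf) auto
    also have "\<dots> = free_lift R M t x \<oplus>\<^bsub>M\<^esub> free_lift R M t y"
      using free_lift_superset[OF assms(1) x assms(2) U] free_lift_superset[OF assms(1) y assms(2) U]
      by auto
    finally show "free_lift R M t (x \<oplus>\<^bsub>free_mod R S\<^esub> y) = free_lift R M t x \<oplus>\<^bsub>M\<^esub> free_lift R M t y" .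
  next
    fix r x assume r: "r \<in> carrier R" and x: "x \<in> carrier (free_mod R S)"
    let ?U = "{s. x s \<noteq> \<zero>\<^bsub>R\<^esub>}"
    have "free_lift R M t (r \<odot>\<^bsub>free_mod R S\<^esub> x) = (\<Oplus>\<^bsub>M\<^esub> s \<in> ?U. (r \<odot>\<^bsub>free_mod R S\<^esub> x) s \<odot>\<^bsub>M\<^esub> t s)"
      using F.smult_closed[OF r x] r supp[OF x]
      by (intro free_lift_superset[OF assms(1) _ assms(2)]) (auto simp: free_mod_simps(4))
    also have "\<dots> = (\<Oplus>\<^bsub>M\<^esub> s \<in> ?U. r \<odot>\<^bsub>M\<^esub> (x s \<odot>\<^bsub>M\<^esub> t s))"
      using supp[OF x] t r
      by (intro M.finsum_cong') (auto simp: free_mod_simps(4) subset_iff M.smult_assoc1)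
    also have "\<dots> = r \<odot>\<^bsub>M\<^esub> free_lift R M t x"
      unfolding free_lift_def using supp[OF x] t r
      by (intro M.finsum_smult_ldistr[symmetric]) auto
    finally show "free_lift R M t (r \<odot>\<^bsub>free_mod R S\<^esub> x) = r \<odot>\<^bsub>M\<^esub> free_lift R M t x" .
  qed
qed

lemma free_lift_basis:
  assumes "module R M" "t s \<in> carrier M"
  shows "free_lift R M t (basis_vec R s) = t s"
proof -
  interpret M: module R M by fact
  have "free_lift R M t (basis_vec R s) = (\<Oplus>\<^bsub>M\<^esub> u \<in> {s}. basis_vec R s u \<odot>\<^bsub>M\<^esub> t u)"
    using assms
    by (intro free_lift_superset[where S = "{s}"] basis_vec_closed M.R.is_cring)
      (auto simp: basis_vec_def)
  also have "\<dots> = t s" using assms(2) by (simp add: basis_vec_def)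
  finally show ?thesis .
qed

section \<open>Maps of free modules induced by maps of bases\<close>

lemma free_map_superset:
  assumes "cring R" "x \<in> carrier (free_mod R S)" "finite U" "{s. x s \<noteq> \<zero>\<^bsub>R\<^esub>} \<subseteq> U"
  shows "free_map R h x t = (\<Oplus>\<^bsub>R\<^esub> s \<in> {s \<in> U. h s = t}. x s)"
proof -
  interpret R: cring R by fact
  show ?thesis
    unfolding free_map_def using assms(2-4)
    by (intro R.add.finprod_mono_neutral_cong_left) (auto simp: free_mod_simps)
qed

lemma free_map_hom:
  assumes "cring R" "h \<in> S \<rightarrow> T"
  shows "free_map R h \<in> mod_hom R (free_mod R S) (free_mod R T)"
proof -
  interpret R: cring R by fact
  have supp: "finite {s. x s \<noteq> \<zero>\<^bsub>R\<^esub>}" "{s. x s \<noteq> \<zero>\<^bsub>R\<^esub>} \<subseteq> S" "\<And>s. x s \<in> carrier R"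
    if "x \<in> carrier (free_mod R S)" for x
    using that by (auto simp: free_mod_simps)
  interpret F: module R "free_mod R S" by (rule module_free_mod) fact
  show ?thesis
  proof (rule mod_homI)
    fix x assume x: "x \<in> carrier (free_mod R S)"
    \<comment> \<open>A coordinate without a supported preimage is an empty sum. This gives both the
      finiteness of the new support and its containment in \<open>T\<close>.\<close>
    have 0: "free_map R h x t = \<zero>\<^bsub>R\<^esub>" if "t \<notin> h ` {s. x s \<noteq> \<zero>\<^bsub>R\<^esub>}" for t
    proof -
      have "{s. x s \<noteq> \<zero>\<^bsub>R\<^esub> \<and> h s = t} = {}" using that by auto
      then show ?thesis by (simp only: free_map_def R.finsum_empty)
    qed
    then have "{t. free_map R h x t \<noteq> \<zero>\<^bsub>R\<^esub>} \<subseteq> h ` {s. x s \<noteq> \<zero>\<^bsub>R\<^esub>}" by auto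
    then have "finite {t. free_map R h x t \<noteq> \<zero>\<^bsub>R\<^esub>}"
      using supp(1)[OF x] by (meson finite_imageI finite_subset)
    moreover have "free_map R h x t \<in> carrier R" for t
      unfolding free_map_def using supp(3)[OF x] by (intro R.finsum_closed) auto
    moreover have "free_map R h x t = \<zero>\<^bsub>R\<^esub>" if "t \<notin> T" for t
      using that supp(2)[OF x] assms(2) by (intro 0) auto
    ultimately show "free_map R h x \<in> carrier (free_mod R T)"
      by (auto simp: free_mod_simps)
  next
    fix x y assume x: "x \<in> carrier (free_mod R S)" and y: "y \<in> carrier (free_mod R S)"
    let ?U = "{s. x s \<noteq> \<zero>\<^bsub>R\<^esub>} \<union> {s. y s \<noteq> \<zero>\<^bsub>R\<^esub>}"
    have U: "finite ?U" using supp[OF x] supp[OF y] by auto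
    show "free_map R h (x \<oplus>\<^bsub>free_mod R S\<^esub> y) = free_map R h x \<oplus>\<^bsub>free_mod R T\<^esub> free_map R h y"
    proof
      fix t
      have "free_map R h (x \<oplus>\<^bsub>free_mod R S\<^esub> y) t
          = (\<Oplus>\<^bsub>R\<^esub> s \<in> {s \<in> ?U. h s = t}. (x \<oplus>\<^bsub>free_mod R S\<^esub> y) s)"
        using U by (intro free_map_superset[OF assms(1) F.M.a_closed[OF x y]]) (auto simp: free_mod_simps(3))
      also have "\<dots> = (\<Oplus>\<^bsub>R\<^esub> s \<in> {s \<in> ?U. h s = t}. x s) \<oplus>\<^bsub>R\<^esub> (\<Oplus>\<^bsub>R\<^esub> s \<in> {s \<in> ?U. h s = t}. y s)"
        unfolding free_mod_simps(3)
        using supp(3)[OF x] supp(3)[OF y] by (intro R.finsum_addf) auto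
      also have "(\<Oplus>\<^bsub>R\<^esub> s \<in> {s \<in> ?U. h s = t}. x s) = free_map R h x t"
        by (rule free_map_superset[OF assms(1) x U, symmetric]) auto
      also have "(\<Oplus>\<^bsub>R\<^esub> s \<in> {s \<in> ?U. h s = t}. y s) = free_map R h y t"
        by (rule free_map_superset[OF assms(1) y U, symmetric]) auto
      finally show "free_map R h (x \<oplus>\<^bsub>free_mod R S\<^esub> y) t
          = (free_map R h x \<oplus>\<^bsub>free_mod R T\<^esub> free_map R h y) t"
        by (simp add: free_mod_simps)
    qed
  next
    fix r x assume r: "r \<in> carrier R" and x: "x \<in> carrier (free_mod R S)"
    let ?U = "{s. x s \<noteq> \<zero>\<^bsub>R\<^esub>}"
    show "free_map R h (r \<odot>\<^bsub>free_mod R S\<^esub> x) = r \<odot>\<^bsub>free_mod R T\<^esub> free_map R h x"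
    proof
      fix t
      have "free_map R h (r \<odot>\<^bsub>free_mod R S\<^esub> x) t
          = (\<Oplus>\<^bsub>R\<^esub> s \<in> {s \<in> ?U. h s = t}. (r \<odot>\<^bsub>free_mod R S\<^esub> x) s)"
        using r supp[OF x]
          by (intro free_map_superset[OF assms(1) F.smult_closed[OF r x]]) (auto simp: free_mod_simps(4))
      also have "\<dots> = r \<otimes>\<^bsub>R\<^esub> (\<Oplus>\<^bsub>R\<^esub> s \<in> {s \<in> ?U. h s = t}. x s)"
        unfolding free_mod_simps(4)
        using supp[OF x] r by (intro R.finsum_rdistr[symmetric]) auto
      finally show "free_map R h (r \<odot>\<^bsub>free_mod R S\<^esub> x) t = (r \<odot>\<^bsub>free_mod R T\<^esub> free_map R h x) t"
        by (simp add: free_mod_simps free_map_def)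
    qed
  qed
qed

lemma free_map_basis:
  assumes "cring R"
  shows "free_map R h (basis_vec R s) = basis_vec R (h s)"
proof
  interpret R: cring R by fact
  fix t
  have "free_map R h (basis_vec R s) t = (\<Oplus>\<^bsub>R\<^esub> u \<in> {u \<in> {s}. h u = t}. basis_vec R s u)"
    by (intro free_map_superset[where S = "{s}"] basis_vec_closed assms) (auto simp: basis_vec_def)
  also have "\<dots> = basis_vec R (h s) t"
  proof (cases "h s = t")
    case True
    then have "{u \<in> {s}. h u = t} = {s}" by auto
    with True show ?thesis by (simp add: basis_vec_def)
  next
    case False
    then have "{u \<in> {s}. h u = t} = {}" by auto
    with False show ?thesis by (simp only: R.finsum_empty) (auto simp: basis_vec_def)
  qed
  finally show "free_map R h (basis_vec R s) t = basis_vec R (h s) t" .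
qed

section \<open>Tensor products\<close>

lemma module_tensor_free: "cring R \<Longrightarrow> module R (tensor_free R M N)"
  unfolding tensor_free_def by (rule module_free_mod)

lemma tensor_free_basis_closed:
  "cring R \<Longrightarrow> a \<in> carrier M \<Longrightarrow> b \<in> carrier N \<Longrightarrow> basis_vec R (a, b) \<in> carrier (tensor_free R M N)"
  unfolding tensor_free_def by (rule basis_vec_closed) auto

lemma tensor_rels_cases:
  assumes "z \<in> tensor_rels R M N"
  obtains (add_left) a a' b where "a \<in> carrier M" "a' \<in> carrier M" "b \<in> carrier N"
      "z = basis_vec R (a \<oplus>\<^bsub>M\<^esub> a', b) \<ominus>\<^bsub>tensor_free R M N\<^esub>
        (basis_vec R (a, b) \<oplus>\<^bsub>tensor_free R M N\<^esub> basis_vec R (a', b))"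
    | (add_right) a b b' where "a \<in> carrier M" "b \<in> carrier N" "b' \<in> carrier N"
      "z = basis_vec R (a, b \<oplus>\<^bsub>N\<^esub> b') \<ominus>\<^bsub>tensor_free R M N\<^esub>
        (basis_vec R (a, b) \<oplus>\<^bsub>tensor_free R M N\<^esub> basis_vec R (a, b'))"
    | (smult_left) r a b where "r \<in> carrier R" "a \<in> carrier M" "b \<in> carrier N"
      "z = basis_vec R (r \<odot>\<^bsub>M\<^esub> a, b) \<ominus>\<^bsub>tensor_free R M N\<^esub> r \<odot>\<^bsub>tensor_free R M N\<^esub> basis_vec R (a, b)"
    | (smult_right) r a b where "r \<in> carrier R" "a \<in> carrier M" "b \<in> carrier N"
      "z = basis_vec R (a, r \<odot>\<^bsub>N\<^esub> b) \<ominus>\<^bsub>tensor_free R M N\<^esub> r \<odot>\<^bsub>tensor_free R M N\<^esub> basis_vec R (a, b)"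
  using assms unfolding tensor_rels_def Let_def by blast

lemma tensor_rels_intros:
  shows tensor_rels_add_left: "a \<in> carrier M \<Longrightarrow> a' \<in> carrier M \<Longrightarrow> b \<in> carrier N \<Longrightarrow>
      basis_vec R (a \<oplus>\<^bsub>M\<^esub> a', b) \<ominus>\<^bsub>tensor_free R M N\<^esub>
        (basis_vec R (a, b) \<oplus>\<^bsub>tensor_free R M N\<^esub> basis_vec R (a', b)) \<in> tensor_rels R M N"
    and tensor_rels_add_right: "a \<in> carrier M \<Longrightarrow> b \<in> carrier N \<Longrightarrow> b' \<in> carrier N \<Longrightarrow>
      basis_vec R (a, b \<oplus>\<^bsub>N\<^esub> b') \<ominus>\<^bsub>tensor_free R M N\<^esub>
        (basis_vec R (a, b) \<oplus>\<^bsub>tensor_free R M N\<^esub> basis_vec R (a, b')) \<in> tensor_rels R M N"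
    and tensor_rels_smult_left: "r \<in> carrier R \<Longrightarrow> a \<in> carrier M \<Longrightarrow> b \<in> carrier N \<Longrightarrow>
      basis_vec R (r \<odot>\<^bsub>M\<^esub> a, b) \<ominus>\<^bsub>tensor_free R M N\<^esub> r \<odot>\<^bsub>tensor_free R M N\<^esub> basis_vec R (a, b)
        \<in> tensor_rels R M N"
    and tensor_rels_smult_right: "r \<in> carrier R \<Longrightarrow> a \<in> carrier M \<Longrightarrow> b \<in> carrier N \<Longrightarrow>
      basis_vec R (a, r \<odot>\<^bsub>N\<^esub> b) \<ominus>\<^bsub>tensor_free R M N\<^esub> r \<odot>\<^bsub>tensor_free R M N\<^esub> basis_vec R (a, b)
        \<in> tensor_rels R M N"
  unfolding tensor_rels_def Let_def by blast+

lemma tensor_rels_subset: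
  assumes "module R M" "module R N"
  shows "tensor_rels R M N \<subseteq> carrier (tensor_free R M N)"
proof
  interpret M: module R M by fact
  interpret N: module R N by fact
  interpret F: module R "tensor_free R M N" by (rule module_tensor_free) (rule M.R.is_cring)
  fix z assume "z \<in> tensor_rels R M N"
  then show "z \<in> carrier (tensor_free R M N)"
    by (cases rule: tensor_rels_cases) (simp_all add: tensor_free_basis_closed M.R.is_cring)
qed

lemma submodule_tensor_ker:
  assumes "module R M" "module R N"
  shows "submodule (tensor_ker R M N) R (tensor_free R M N)"
  unfolding tensor_ker_def
  by (rule gen_submodule_submodule[OF module_tensor_free[OF module.axioms(1)[OF assms(1)]] tensor_rels_subset[OF assms]])

lemma tensor_rels_ker: "z \<in> tensor_rels R M N \<Longrightarrow> z \<in> tensor_ker R M N"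
  unfolding tensor_ker_def by (rule subsetD[OF gen_submodule_subset])

lemma module_tensor_mod:
  assumes "module R M" "module R N"
  shows "module R (tensor_mod R M N)"
  unfolding tensor_mod_def
  by (rule module_quot_mod[OF module_tensor_free[OF module.axioms(1)[OF assms(1)]] submodule_tensor_ker[OF assms]])

section \<open>Pure tensors and linear maps out of a tensor product\<close>

definition pure_tensor ::
  "('r, 'c) ring_scheme \<Rightarrow> ('r, 'm, 'd) module_scheme \<Rightarrow> ('r, 'n, 'e) module_scheme \<Rightarrow>
    'm \<Rightarrow> 'n \<Rightarrow> ('m \<times> 'n \<Rightarrow> 'r) set"
  where "pure_tensor R M N a b = tensor_ker R M N +>\<^bsub>tensor_free R M N\<^esub> basis_vec R (a, b)"

text \<open>The difference of the two representatives is one of the generating relations, so their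
  cosets coincide.\<close>

lemma pure_tensor_add_left:
  assumes "module R M" "module R N" "a \<in> carrier M" "a' \<in> carrier M" "b \<in> carrier N"
  shows "pure_tensor R M N (a \<oplus>\<^bsub>M\<^esub> a') b =
    pure_tensor R M N a b \<oplus>\<^bsub>tensor_mod R M N\<^esub> pure_tensor R M N a' b"
proof -
  interpret M: module R M by fact
  interpret F: module R "tensor_free R M N" by (rule module_tensor_free) (rule M.R.is_cring)
  note K = submodule_tensor_ker[OF assms(1,2)]
  note e = tensor_free_basis_closed[OF M.R.is_cring _ assms(5), of _ M]
  have "pure_tensor R M N (a \<oplus>\<^bsub>M\<^esub> a') b = tensor_ker R M N +>\<^bsub>tensor_free R M N\<^esub>
      (basis_vec R (a, b) \<oplus>\<^bsub>tensor_free R M N\<^esub> basis_vec R (a', b))"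
    unfolding pure_tensor_def
    using assms e
    by (intro coset_eqI[OF F.module_axioms K] tensor_rels_ker tensor_rels_add_left) auto
  also have "\<dots> = pure_tensor R M N a b \<oplus>\<^bsub>tensor_mod R M N\<^esub> pure_tensor R M N a' b"
    unfolding pure_tensor_def tensor_mod_def
    using assms e by (intro quot_mod_coset_add[OF F.module_axioms K, symmetric])
  finally show ?thesis .
qed

text \<open>Precomposition with the quotient projection turns \<open>F\<close> and \<open>G\<close>
  into linear maps on a free module, and the projection sends its basis vectors to the pure
  tensors.\<close>

lemma tensor_hom_ext:
  assumes "module R M" "module R N" "module R L"
    and "F \<in> mod_hom R (tensor_mod R M N) L" "G \<in> mod_hom R (tensor_mod R M N) L"
    and "\<And>a b. a \<in> carrier M \<Longrightarrow> b \<in> carrier N \<Longrightarrow>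
      F (pure_tensor R M N a b) = G (pure_tensor R M N a b)"
    and "X \<in> carrier (tensor_mod R M N)"
  shows "F X = G X"
proof -
  interpret M: module R M by fact
  let ?p = "\<lambda>x. tensor_ker R M N +>\<^bsub>tensor_free R M N\<^esub> x"
  have p: "?p \<in> mod_hom R (tensor_free R M N) (tensor_mod R M N)"
    unfolding tensor_mod_def
    by (rule quot_mod_proj[OF module_tensor_free[OF M.R.is_cring] submodule_tensor_ker[OF assms(1,2)]])
  obtain x where x: "x \<in> carrier (tensor_free R M N)" "X = ?p x"
    using assms(7) unfolding tensor_mod_def by (rule quot_modE)
  have "F (?p x) = G (?p x)"
  proof (rule free_mod_hom_ext[where f = "\<lambda>x. F (?p x)" and g = "\<lambda>x. G (?p x)"])
    show "(\<lambda>x. F (?p x)) \<in> mod_hom R (free_mod R (carrier M \<times> carrier N)) L"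
      using mod_hom_comp[OF p assms(4)] by (simp only: tensor_free_def)
    show "(\<lambda>x. G (?p x)) \<in> mod_hom R (free_mod R (carrier M \<times> carrier N)) L"
      using mod_hom_comp[OF p assms(5)] by (simp only: tensor_free_def)
    show "x \<in> carrier (free_mod R (carrier M \<times> carrier N))"
      using x(1) by (simp only: tensor_free_def)
    show "F (?p (basis_vec R s)) = G (?p (basis_vec R s))" if "s \<in> carrier M \<times> carrier N" for s
      using assms(6)[unfolded pure_tensor_def] that by auto
  qed (fact assms(3) M.R.is_cring)+
  then show ?thesis using x(2) by simp
qed

section \<open>Functoriality of the tensor product\<close>

context
  fixes R :: "('r, 'c) ring_scheme"
    and M :: "('r, 'm, 'd) module_scheme" and N :: "('r, 'n, 'e) module_scheme"
    and M' :: "('r, 'm', 'd') module_scheme" and N' :: "('r, 'n', 'e') module_scheme"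
  assumes M: "module R M" and N: "module R N" and M': "module R M'" and N': "module R N'"
begin

interpretation M: module R M by (rule M)

lemma free_map_tensor_hom:
  assumes "f \<in> mod_hom R M M'" "g \<in> mod_hom R N N'"
  shows "free_map R (map_prod f g) \<in> mod_hom R (tensor_free R M N) (tensor_free R M' N')"
  unfolding tensor_free_def
  using mod_hom_closed[OF assms(1)] mod_hom_closed[OF assms(2)]
  by (intro free_map_hom M.R.is_cring) auto

text \<open>By linearity of \<open>f\<close> and \<open>g\<close>, each of the four kinds of
  relation goes to a relation of the same kind. The preimage of the target kernel is a submodule,
  hence contains all that the relations generate.\<close>

lemma free_map_tensor_ker:
  assumes "f \<in> mod_hom R M M'" "g \<in> mod_hom R N N'"
  shows "free_map R (map_prod f g) ` tensor_ker R M N \<subseteq> tensor_ker R M' N'"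
proof -
  interpret N: module R N by (rule N)
  interpret F: module R "tensor_free R M N" by (rule module_tensor_free) (rule M.R.is_cring)
  interpret F': module R "tensor_free R M' N'" by (rule module_tensor_free) (rule M.R.is_cring)
  let ?h = "free_map R (map_prod f g)"
  note h = free_map_tensor_hom[OF assms]
  note f = mod_homD[OF assms(1)] and g = mod_homD[OF assms(2)]
  note hs = mod_hom_minus[OF F.module_axioms F'.module_axioms h] mod_hom_add[OF h] mod_hom_smult[OF h]
    tensor_free_basis_closed M.R.is_cring
  have "?h z \<in> tensor_rels R M' N'" if "z \<in> tensor_rels R M N" for z
    using that
  proof (cases rule: tensor_rels_cases)
    case (add_left a a' b)
    then show ?thesis
      using tensor_rels_add_left[of "f a" M' "f a'" "g b" N' R]
      by (simp add: hs free_map_basis f g)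
  next
    case (add_right a b b')
    then show ?thesis
      using tensor_rels_add_right[of "f a" M' "g b" N' "g b'" R]
      by (simp add: hs free_map_basis f g)
  next
    case (smult_left r a b)
    then show ?thesis
      using tensor_rels_smult_left[of r R "f a" M' "g b" N']
      by (simp add: hs free_map_basis f g)
  next
    case (smult_right r a b)
    then show ?thesis
      using tensor_rels_smult_right[of r R "f a" M' "g b" N']
      by (simp add: hs free_map_basis f g)
  qed
  then have "tensor_rels R M N \<subseteq> {x \<in> carrier (tensor_free R M N). ?h x \<in> tensor_ker R M' N'}"
    using tensor_rels_subset[OF M N] tensor_rels_ker by blast
  moreover have "submodule {x \<in> carrier (tensor_free R M N). ?h x \<in> tensor_ker R M' N'} R (tensor_free R M N)"
    by (rule submodule_preimage[OF F.module_axioms F'.module_axioms h submodule_tensor_ker[OF M' N']])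
  ultimately have "tensor_ker R M N \<subseteq> {x \<in> carrier (tensor_free R M N). ?h x \<in> tensor_ker R M' N'}"
    unfolding tensor_ker_def[of R M N] by (intro gen_submodule_minimal)
  then show ?thesis by auto
qed

lemma tensor_map_hom:
  assumes "f \<in> mod_hom R M M'" "g \<in> mod_hom R N N'"
  shows "tensor_map R M' N' f g \<in> mod_hom R (tensor_mod R M N) (tensor_mod R M' N')"
  unfolding tensor_map_def tensor_mod_def
  by (rule coset_map_hom[OF module_tensor_free[OF M.R.is_cring] module_tensor_free[OF M.R.is_cring]
        submodule_tensor_ker[OF M N] submodule_tensor_ker[OF M' N']
        free_map_tensor_hom[OF assms] free_map_tensor_ker[OF assms]])

lemma tensor_map_pure:
  assumes "f \<in> mod_hom R M M'" "g \<in> mod_hom R N N'" "a \<in> carrier M" "b \<in> carrier N"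
  shows "tensor_map R M' N' f g (pure_tensor R M N a b) = pure_tensor R M' N' (f a) (g b)"
proof -
  have "tensor_map R M' N' f g (pure_tensor R M N a b)
      = tensor_ker R M' N' +>\<^bsub>tensor_free R M' N'\<^esub> free_map R (map_prod f g) (basis_vec R (a, b))"
    unfolding tensor_map_def pure_tensor_def
    by (rule coset_map_coset[OF module_tensor_free[OF M.R.is_cring] module_tensor_free[OF M.R.is_cring]
          submodule_tensor_ker[OF M N] submodule_tensor_ker[OF M' N'] free_map_tensor_hom[OF assms(1,2)]
          free_map_tensor_ker[OF assms(1,2)] tensor_free_basis_closed[OF M.R.is_cring assms(3,4)]])
  then show ?thesis by (simp add: free_map_basis M.R.is_cring pure_tensor_def)
qed

text \<open>Makes it possible to tensor a homotopy identity, a sum of two maps. The sum enters as a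
  function \<open>h\<close> prescribed on \<open>carrier M\<close> only, because such identities
  hold only there.\<close>

lemma tensor_map_add_left:
  assumes "f \<in> mod_hom R M M'" "f' \<in> mod_hom R M M'" "g \<in> mod_hom R N N'"
    and "\<And>x. x \<in> carrier M \<Longrightarrow> h x = f x \<oplus>\<^bsub>M'\<^esub> f' x"
    and "X \<in> carrier (tensor_mod R M N)"
  shows "tensor_map R M' N' h g X =
    tensor_map R M' N' f g X \<oplus>\<^bsub>tensor_mod R M' N'\<^esub> tensor_map R M' N' f' g X"
proof -
  have h: "h \<in> mod_hom R M M'"
    by (rule mod_hom_cong[OF mod_hom_plus[OF M' assms(1,2)] assms(4) M])
  show ?thesis
    by (rule tensor_hom_ext[OF M N module_tensor_mod[OF M' N'] tensor_map_hom[OF h assms(3)]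
          mod_hom_plus[OF module_tensor_mod[OF M' N'] tensor_map_hom[OF assms(1,3)]
            tensor_map_hom[OF assms(2,3)]] _ assms(5)])
      (simp add: tensor_map_pure assms h pure_tensor_add_left M' N'
        mod_hom_closed[OF assms(1)] mod_hom_closed[OF assms(2)] mod_hom_closed[OF assms(3)])
qed

lemma tensor_map_zero_left:
  assumes "g \<in> mod_hom R N N'" "\<And>x. x \<in> carrier M \<Longrightarrow> h x = \<zero>\<^bsub>M'\<^esub>" "X \<in> carrier (tensor_mod R M N)"
  shows "tensor_map R M' N' h g X = \<zero>\<^bsub>tensor_mod R M' N'\<^esub>"
proof -
  interpret M': module R M' by (rule M')
  interpret T: module R "tensor_mod R M' N'" by (rule module_tensor_mod[OF M' N'])
  have h: "h \<in> mod_hom R M M'"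
    by (rule mod_hom_cong[OF mod_hom_const_zero[OF M'] assms(2) M])
  \<comment> \<open>The zero map is the sum of itself with itself, so its value equals its own
    double.\<close>
  have "tensor_map R M' N' h g X = tensor_map R M' N' h g X \<oplus>\<^bsub>tensor_mod R M' N'\<^esub> tensor_map R M' N' h g X"
    by (rule tensor_map_add_left[OF h h assms(1) _ assms(3)]) (simp add: assms(2))
  moreover have "tensor_map R M' N' h g X \<in> carrier (tensor_mod R M' N')"
    by (rule mod_hom_closed[OF tensor_map_hom[OF h assms(1)] assms(3)])
  ultimately show ?thesis by (metis T.M.add.r_cancel_one')
qed

lemma tensor_map_zero_right:
  assumes "f \<in> mod_hom R M M'" "\<And>x. x \<in> carrier N \<Longrightarrow> h x = \<zero>\<^bsub>N'\<^esub>" "X \<in> carrier (tensor_mod R M N)"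
  shows "tensor_map R M' N' f h X = \<zero>\<^bsub>tensor_mod R M' N'\<^esub>"
proof -
  interpret M': module R M' by (rule M')
  interpret N': module R N' by (rule N')
  interpret T: module R "tensor_mod R M' N'" by (rule module_tensor_mod[OF M' N'])
  interpret F: module R "tensor_free R M' N'" by (rule module_tensor_free) (rule M.R.is_cring)
  have h: "h \<in> mod_hom R N N'"
    by (rule mod_hom_cong[OF mod_hom_const_zero[OF N'] assms(2) N])
  have "pure_tensor R M' N' a \<zero>\<^bsub>N'\<^esub> = \<zero>\<^bsub>tensor_mod R M' N'\<^esub>" if a: "a \<in> carrier M'" for a
  proof -
    have e: "basis_vec R (a, \<zero>\<^bsub>N'\<^esub>) \<in> carrier (tensor_free R M' N')"
      using a by (intro tensor_free_basis_closed M.R.is_cring) auto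
    have zero: "\<ominus>\<^bsub>tensor_free R M' N'\<^esub> \<zero>\<^bsub>tensor_free R M' N'\<^esub> = \<zero>\<^bsub>tensor_free R M' N'\<^esub>"
      by (metis F.M.r_neg F.M.l_zero F.M.a_inv_closed F.M.zero_closed)
    \<comment> \<open>The relation for the scalar 0 acting on the element 0: its subtrahend
      vanishes, so the relation is the basis vector itself.\<close>
    have "basis_vec R (a, \<zero>\<^bsub>R\<^esub> \<odot>\<^bsub>N'\<^esub> \<zero>\<^bsub>N'\<^esub>) \<ominus>\<^bsub>tensor_free R M' N'\<^esub>
        \<zero>\<^bsub>R\<^esub> \<odot>\<^bsub>tensor_free R M' N'\<^esub> basis_vec R (a, \<zero>\<^bsub>N'\<^esub>) \<in> tensor_ker R M' N'"
      using a by (intro tensor_rels_ker tensor_rels_smult_right) auto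
    then have "basis_vec R (a, \<zero>\<^bsub>N'\<^esub>) \<in> tensor_ker R M' N'"
      by (simp only: a_minus_def N'.smult_r_null M.R.zero_closed F.smult_l_null[OF e] zero F.M.r_zero[OF e])
    then show ?thesis
      unfolding pure_tensor_def tensor_mod_def
      by (rule quot_mod_coset_eq_zero[OF F.module_axioms submodule_tensor_ker[OF M' N']])
  qed
  then show ?thesis
    by (intro tensor_hom_ext[OF M N module_tensor_mod[OF M' N'] tensor_map_hom[OF assms(1) h]
          mod_hom_const_zero[OF module_tensor_mod[OF M' N']] _ assms(3)])
      (simp add: tensor_map_pure assms h mod_hom_closed[OF assms(1)])
qed

end

lemma tensor_map_cong:
  assumes "module R M" "module R N" "module R M'" "module R N'"
    and "f \<in> mod_hom R M M'" "g \<in> mod_hom R N N'"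
    and "\<And>x. x \<in> carrier M \<Longrightarrow> h x = f x" "X \<in> carrier (tensor_mod R M N)"
  shows "tensor_map R M' N' h g X = tensor_map R M' N' f g X"
proof -
  have h: "h \<in> mod_hom R M M'" by (rule mod_hom_cong[OF assms(5,7,1)])
  show ?thesis
    by (rule tensor_hom_ext[OF assms(1,2) module_tensor_mod[OF assms(3,4)]
          tensor_map_hom[OF assms(1-4) h assms(6)] tensor_map_hom[OF assms(1-6)] _ assms(8)])
      (simp add: tensor_map_pure[OF assms(1-4)] assms(5-7) h)
qed

text \<open>Both sides are linear and agree on pure tensors. The composites are arbitrary functions
  \<open>h\<close> and \<open>k\<close> fixed on the carriers, so that identity maps and structure
  maps can be absorbed without rewriting under lambdas.\<close>

lemma tensor_map_comp:
  assumes "module R M" "module R N" "module R M'" "module R N'" "module R M''" "module R N''"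
    and "f \<in> mod_hom R M M'" "g \<in> mod_hom R N N'" "f' \<in> mod_hom R M' M''" "g' \<in> mod_hom R N' N''"
    and "\<And>x. x \<in> carrier M \<Longrightarrow> h x = f' (f x)" "\<And>y. y \<in> carrier N \<Longrightarrow> k y = g' (g y)"
    and "X \<in> carrier (tensor_mod R M N)"
  shows "tensor_map R M'' N'' f' g' (tensor_map R M' N' f g X) = tensor_map R M'' N'' h k X"
proof -
  have h: "h \<in> mod_hom R M M''"
    by (rule mod_hom_cong[OF mod_hom_comp[OF assms(7,9)] assms(11,1)])
  have k: "k \<in> mod_hom R N N''"
    by (rule mod_hom_cong[OF mod_hom_comp[OF assms(8,10)] assms(12,2)])
  note t = tensor_map_hom[OF assms(1-4,7,8)] and t' = tensor_map_hom[OF assms(3-6,9,10)]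
    and t'' = tensor_map_hom[OF assms(1,2,5,6) h k]
  show ?thesis
    by (rule tensor_hom_ext[OF assms(1,2) module_tensor_mod[OF assms(5,6)] mod_hom_comp[OF t t'] t'' _ assms(13)])
      (simp add: tensor_map_pure[OF assms(1-4,7,8)] tensor_map_pure[OF assms(3-6,9,10)]
        tensor_map_pure[OF assms(1,2,5,6) h k] assms(11,12) mod_hom_closed[OF assms(7)]
        mod_hom_closed[OF assms(8)])
qed

section \<open>Persistence modules\<close>

lemma mon_leD: "mon_le I i j \<Longrightarrow> i \<in> carrier I" "mon_le I i j \<Longrightarrow> j \<in> carrier I"
  by (auto simp: mon_le_def)

lemma mon_le_refl:
  assumes "comm_monoid I" "i \<in> carrier I"
  shows "mon_le I i i"
proof -
  interpret comm_monoid I by fact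
  show ?thesis using assms(2) by (auto simp: mon_le_def intro!: bexI[of _ "\<one>\<^bsub>I\<^esub>"])
qed

lemma mon_le_trans:
  assumes "comm_monoid I" "mon_le I i j" "mon_le I j k"
  shows "mon_le I i k"
proof -
  interpret comm_monoid I by fact
  obtain g h where "i \<in> carrier I" "g \<in> carrier I" "h \<in> carrier I" "j = g \<otimes>\<^bsub>I\<^esub> i" "k = h \<otimes>\<^bsub>I\<^esub> j"
    using assms(2,3) by (auto simp: mon_le_def)
  then show ?thesis
    by (auto simp: mon_le_def m_assoc[symmetric] intro!: bexI[of _ "h \<otimes>\<^bsub>I\<^esub> g"])
qed

lemma mon_le_add:
  assumes "comm_monoid I" "i \<in> carrier I" "e \<in> carrier I"
  shows "mon_le I i (i \<otimes>\<^bsub>I\<^esub> e)"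
proof -
  interpret comm_monoid I by fact
  show ?thesis using assms(2,3) by (auto simp: mon_le_def m_comm intro!: bexI[of _ e])
qed

lemma mon_le_add_mono:
  assumes "comm_monoid I" "mon_le I i j" "e \<in> carrier I"
  shows "mon_le I (i \<otimes>\<^bsub>I\<^esub> e) (j \<otimes>\<^bsub>I\<^esub> e)"
proof -
  interpret comm_monoid I by fact
  obtain h where "i \<in> carrier I" "h \<in> carrier I" "j = h \<otimes>\<^bsub>I\<^esub> i"
    using assms(2) by (auto simp: mon_le_def)
  then show ?thesis using assms(3) by (auto simp: mon_le_def m_assoc)
qed

lemma persistence_moduleD:
  assumes "persistence_module R I M"
  shows persistence_module_comp: "i \<in> carrier I \<Longrightarrow> module R (pcomp M i)"
    and persistence_module_map: "mon_le I i j \<Longrightarrow> pmap M i j \<in> mod_hom R (pcomp M i) (pcomp M j)"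
    and persistence_module_id: "i \<in> carrier I \<Longrightarrow> x \<in> carrier (pcomp M i) \<Longrightarrow> pmap M i i x = x"
    and persistence_module_comp_map: "mon_le I i j \<Longrightarrow> mon_le I j k \<Longrightarrow> x \<in> carrier (pcomp M i) \<Longrightarrow>
      pmap M j k (pmap M i j x) = pmap M i k x"
  using assms by (auto simp: persistence_module_def)

lemma pmod_homD:
  assumes "f \<in> pmod_hom R I M N"
  shows pmod_hom_comp: "i \<in> carrier I \<Longrightarrow> f i \<in> mod_hom R (pcomp M i) (pcomp N i)"
    and pmod_hom_natural: "mon_le I i j \<Longrightarrow> x \<in> carrier (pcomp M i) \<Longrightarrow>
      pmap N i j (f i x) = f j (pmap M i j x)"
  using assms by (auto simp: pmod_hom_def)

section \<open>Componentwise projectivity\<close>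

definition gen_index :: "('i, 'k) monoid_scheme \<Rightarrow> ('i, 'r, 'p) pmod \<Rightarrow> 'i \<Rightarrow> ('i \<times> 'p) set"
  where "gen_index I P j = {(i, x). mon_le I i j \<and> x \<in> carrier (pcomp P i)}"

text \<open>Elements of \<open>free_mod\<close> are functions on the whole index type, extended by
  zero, and \<open>gen_index\<close> grows with \<open>j\<close>. The structure maps are therefore
  inclusions, written as the identity function.\<close>

definition free_pmod ::
  "('r, 'c) ring_scheme \<Rightarrow> ('i, 'k) monoid_scheme \<Rightarrow> ('i, 'r, 'p) pmod \<Rightarrow> ('i, 'r, 'i \<times> 'p \<Rightarrow> 'r) pmod"
  where "free_pmod R I P = \<lparr>pcomp = (\<lambda>j. free_mod R (gen_index I P j)), pmap = (\<lambda>i j x. x)\<rparr>"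

text \<open>The canonical map onto \<open>P\<close>: a generator \<open>(i, x)\<close> represents
  \<open>x\<close> born at \<open>i\<close>, and at stage \<open>j\<close> it goes to the image of
  \<open>x\<close> there.\<close>

definition free_cover ::
  "('r, 'c) ring_scheme \<Rightarrow> ('i, 'r, 'p) pmod \<Rightarrow> 'i \<Rightarrow> ('i \<times> 'p \<Rightarrow> 'r) \<Rightarrow> 'p"
  where "free_cover R P j = free_lift R (pcomp P j) (\<lambda>(i, x). pmap P i j x)"

lemma persistence_module_free_pmod:
  assumes "cring R" "comm_monoid I"
  shows "persistence_module R I (free_pmod R I P)"
proof -
  have sub: "gen_index I P i \<subseteq> gen_index I P j" if "mon_le I i j" for i j
    using that mon_le_trans[OF assms(2)] by (auto simp: gen_index_def)
  then have "(\<lambda>x. x) \<in> mod_hom R (free_mod R (gen_index I P i)) (free_mod R (gen_index I P j))"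
    if "mon_le I i j" for i j
    using contra_subsetD[OF sub[OF that]] by (intro mod_homI) (auto simp: free_mod_simps)
  then show ?thesis
    by (simp add: persistence_module_def free_pmod_def module_free_mod assms)
qed

lemma gen_index_map:
  assumes "comm_monoid I" "persistence_module R I P" "mon_le I i j"
  shows "(\<lambda>(k, x). pmap P k j x) \<in> gen_index I P i \<rightarrow> carrier (pcomp P j)"
  using mod_hom_closed[OF persistence_module_map[OF assms(2)]] mon_le_trans[OF assms(1) _ assms(3)]
  by (auto simp: gen_index_def)

text \<open>Linearity allows naturality to be tested on generators \<open>(k, y)\<close>, where it
  is the functoriality of \<open>P\<close> along \<open>k\<close>, \<open>i\<close>,
  \<open>j\<close>.\<close>

lemma free_cover_hom:
  assumes "cring R" "comm_monoid I" "persistence_module R I P"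
  shows "free_cover R P \<in> pmod_hom R I (free_pmod R I P) P"
proof -
  have hom: "free_cover R P j \<in> mod_hom R (free_mod R (gen_index I P i)) (pcomp P j)"
    if "mon_le I i j" for i j
    unfolding free_cover_def
    by (intro free_lift_hom gen_index_map[OF assms(2,3) that] persistence_module_comp[OF assms(3)]
        mon_leD[OF that])
  have basis: "free_cover R P j (basis_vec R (i, x)) = pmap P i j x"
    if "mon_le I i j" "x \<in> carrier (pcomp P i)" for i j x
    unfolding free_cover_def
    using free_lift_basis[OF persistence_module_comp[OF assms(3) mon_leD(2)[OF that(1)]],
        of "\<lambda>(i, x). pmap P i j x" "(i, x)"]
      mod_hom_closed[OF persistence_module_map[OF assms(3) that(1)] that(2)] by simp
  have "pmap P i j (free_cover R P i x) = free_cover R P j x"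
    if ij: "mon_le I i j" and x: "x \<in> carrier (free_mod R (gen_index I P i))" for i j x
  proof (rule free_mod_hom_ext[OF assms(1) persistence_module_comp[OF assms(3) mon_leD(2)[OF ij]]
        mod_hom_comp[OF hom persistence_module_map[OF assms(3) ij]] hom[OF ij] _ x])
    show "mon_le I i i" by (rule mon_le_refl[OF assms(2) mon_leD(1)[OF ij]])
    fix s assume "s \<in> gen_index I P i"
    then obtain k y where s: "s = (k, y)" "mon_le I k i" "y \<in> carrier (pcomp P k)"
      by (auto simp: gen_index_def)
    have "mon_le I k j" by (rule mon_le_trans[OF assms(2) s(2) ij])
    with s ij show "pmap P i j (free_cover R P i (basis_vec R s)) = free_cover R P j (basis_vec R s)"
      by (simp add: basis persistence_module_comp_map[OF assms(3)])
  qed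
  then show ?thesis
    using hom mon_le_refl[OF assms(2)] by (auto simp: pmod_hom_def free_pmod_def)
qed

lemma free_cover_surj:
  assumes "cring R" "comm_monoid I" "persistence_module R I P"
  shows "pmod_surj I (free_pmod R I P) P (free_cover R P)"
  unfolding pmod_surj_def
proof (intro ballI equalityI subsetI)
  fix i y assume i: "i \<in> carrier I" and y: "y \<in> free_cover R P i ` carrier (pcomp (free_pmod R I P) i)"
  then show "y \<in> carrier (pcomp P i)"
    using mod_hom_closed[OF pmod_hom_comp[OF free_cover_hom[OF assms] i]] by auto
next
  fix i y assume i: "i \<in> carrier I" and y: "y \<in> carrier (pcomp P i)"
  \<comment> \<open>The generator born at stage \<open>i\<close> itself is a preimage, since the
    structure map from \<open>i\<close> to \<open>i\<close> is the identity.\<close>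
  have "free_cover R P i (basis_vec R (i, y)) = y"
    unfolding free_cover_def
    using free_lift_basis[OF persistence_module_comp[OF assms(3) i], of "\<lambda>(k, x). pmap P k i x" "(i, y)"]
      persistence_module_id[OF assms(3) i y] y by simp
  moreover have "basis_vec R (i, y) \<in> carrier (pcomp (free_pmod R I P) i)"
    using mon_le_refl[OF assms(2) i] y
    by (auto simp: free_pmod_def gen_index_def intro: basis_vec_closed[OF assms(1)])
  ultimately show "y \<in> free_cover R P i ` carrier (pcomp (free_pmod R I P) i)"
    by (metis image_eqI)
qed

text \<open>The component of \<open>P\<close> at \<open>i\<close> is a retract of a free module:
  \<open>h\<close> is pulled back along the cover, lifted there on the basis, and restricted along
  the section. Asking \<open>h\<close> to take values in the image of \<open>q\<close> is what fits
  a differential of an exact complex.\<close>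

lemma projective_pmod_component_lift:
  assumes "cring R" "comm_monoid I" "projective_pmod R I P" "i \<in> carrier I"
    and "module R X" "module R Y" "q \<in> mod_hom R X Y" "h \<in> mod_hom R (pcomp P i) Y"
    and "\<And>x. x \<in> carrier (pcomp P i) \<Longrightarrow> h x \<in> q ` carrier X"
  shows "\<exists>g \<in> mod_hom R (pcomp P i) X. \<forall>x \<in> carrier (pcomp P i). q (g x) = h x"
proof -
  have P: "persistence_module R I P" using assms(3) by (simp add: projective_pmod_def)
  let ?F = "free_mod R (gen_index I P i)"
  \<comment> \<open>Lifting the identity of \<open>P\<close> along the free cover gives the section
    \<open>\<sigma>\<close>; the types of this cover are those over which
    \<open>projective_pmod\<close> quantifies.\<close>
  have "(\<lambda>i x. x) \<in> pmod_hom R I P P"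
    by (simp add: pmod_hom_def mod_hom_id)
  then obtain \<sigma> where \<sigma>: "\<sigma> \<in> pmod_hom R I P (free_pmod R I P)"
    "\<And>i x. i \<in> carrier I \<Longrightarrow> x \<in> carrier (pcomp P i) \<Longrightarrow> free_cover R P i (\<sigma> i x) = x"
    using assms(3) persistence_module_free_pmod[OF assms(1,2)] P free_cover_hom[OF assms(1,2) P]
      free_cover_surj[OF assms(1,2) P]
    unfolding projective_pmod_def by metis
  have \<sigma>i: "\<sigma> i \<in> mod_hom R (pcomp P i) ?F"
    using pmod_hom_comp[OF \<sigma>(1) assms(4)] by (simp add: free_pmod_def)
  have c: "free_cover R P i \<in> mod_hom R ?F (pcomp P i)"
    using pmod_hom_comp[OF free_cover_hom[OF assms(1,2) P] assms(4)] by (simp add: free_pmod_def)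
  \<comment> \<open>Preimages are chosen for basis vectors only; linearity comes afterwards from
    \<open>free_lift\<close>.\<close>
  have "\<exists>t. \<forall>s \<in> gen_index I P i. t s \<in> carrier X \<and> q (t s) = h (free_cover R P i (basis_vec R s))"
  proof (rule bchoice, rule ballI)
    fix s assume "s \<in> gen_index I P i"
    then have "free_cover R P i (basis_vec R s) \<in> carrier (pcomp P i)"
      by (intro mod_hom_closed[OF c] basis_vec_closed assms(1))
    then show "\<exists>t. t \<in> carrier X \<and> q t = h (free_cover R P i (basis_vec R s))"
      using assms(9) by (metis imageE)
  qed
  then obtain t where t: "t \<in> gen_index I P i \<rightarrow> carrier X"
    "\<And>s. s \<in> gen_index I P i \<Longrightarrow> q (t s) = h (free_cover R P i (basis_vec R s))" by auto
  have T: "free_lift R X t \<in> mod_hom R ?F X" by (rule free_lift_hom[OF assms(5) t(1)])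
  have qT: "q (free_lift R X t y) = h (free_cover R P i y)" if y: "y \<in> carrier ?F" for y
    by (rule free_mod_hom_ext[OF assms(1,6) mod_hom_comp[OF T assms(7)] mod_hom_comp[OF c assms(8)] _ y])
      (use t in \<open>auto simp: free_lift_basis[OF assms(5)] Pi_iff\<close>)
  show ?thesis
    using qT mod_hom_closed[OF \<sigma>i] \<sigma>(2)[OF assms(4)]
    by (intro bexI[OF _ mod_hom_comp[OF \<sigma>i T]]) auto
qed

section \<open>Complexes of modules\<close>

text \<open>Only one degree is needed at a time, so the induction carries just the identity \<open>d s d = \<phi> d\<close>,
  which is all that the construction of the next stage of the homotopy uses.\<close>

lemma null_homotopy:
  fixes C :: "nat \<Rightarrow> ('r, 'p, 'd) module_scheme" and D :: "nat \<Rightarrow> ('r, 'q, 'e) module_scheme"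
  assumes C: "\<And>n. module R (C n)" and D: "\<And>n. module R (D n)"
    and dC: "\<And>n. dC n \<in> mod_hom R (C (Suc n)) (C n)" and dD: "\<And>n. dD n \<in> mod_hom R (D (Suc n)) (D n)"
    and dC2: "\<And>n x. x \<in> carrier (C (Suc (Suc n))) \<Longrightarrow> dC n (dC (Suc n) x) = \<zero>\<^bsub>C n\<^esub>"
    and exact: "\<And>n x. x \<in> carrier (D (Suc n)) \<Longrightarrow> dD n x = \<zero>\<^bsub>D n\<^esub> \<Longrightarrow>
      x \<in> dD (Suc n) ` carrier (D (Suc (Suc n)))"
    and \<phi>: "\<And>n. \<phi> n \<in> mod_hom R (C n) (D n)"
    and comm: "\<And>n x. x \<in> carrier (C (Suc n)) \<Longrightarrow> dD n (\<phi> (Suc n) x) = \<phi> n (dC n x)"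
    and \<phi>0: "\<And>x. x \<in> carrier (C 0) \<Longrightarrow> \<phi> 0 x \<in> dD 0 ` carrier (D (Suc 0))"
    and lift: "\<And>n h. h \<in> mod_hom R (C n) (D n) \<Longrightarrow>
      (\<And>x. x \<in> carrier (C n) \<Longrightarrow> h x \<in> dD n ` carrier (D (Suc n))) \<Longrightarrow>
      \<exists>s \<in> mod_hom R (C n) (D (Suc n)). \<forall>x \<in> carrier (C n). dD n (s x) = h x"
  shows "\<exists>s \<in> mod_hom R (C 0) (D (Suc 0)). \<forall>x \<in> carrier (C 0). \<phi> 0 x = dD 0 (s x)"
    and "\<exists>s \<in> mod_hom R (C (Suc n)) (D (Suc (Suc n))). \<exists>s' \<in> mod_hom R (C n) (D (Suc n)).
      \<forall>x \<in> carrier (C (Suc n)). \<phi> (Suc n) x = dD (Suc n) (s x) \<oplus>\<^bsub>D (Suc n)\<^esub> s' (dC n x)"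
proof -
  obtain s0 where s0: "s0 \<in> mod_hom R (C 0) (D (Suc 0))" "\<And>x. x \<in> carrier (C 0) \<Longrightarrow> dD 0 (s0 x) = \<phi> 0 x"
    using lift[OF \<phi> \<phi>0] by auto
  then show "\<exists>s \<in> mod_hom R (C 0) (D (Suc 0)). \<forall>x \<in> carrier (C 0). \<phi> 0 x = dD 0 (s x)"
    by (intro bexI[OF _ s0(1)]) auto
  have step: "\<exists>s \<in> mod_hom R (C (Suc n)) (D (Suc (Suc n))).
      \<forall>x \<in> carrier (C (Suc n)). \<phi> (Suc n) x = dD (Suc n) (s x) \<oplus>\<^bsub>D (Suc n)\<^esub> s' (dC n x)"
    if s': "s' \<in> mod_hom R (C n) (D (Suc n))"
      and hs': "\<And>x. x \<in> carrier (C (Suc n)) \<Longrightarrow> dD n (s' (dC n x)) = \<phi> n (dC n x)" for n s'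
  proof -
    interpret D: module R "D (Suc n)" by (rule D)
    interpret D': module R "D n" by (rule D)
    \<comment> \<open>What the term \<open>s' d\<close> leaves of \<open>\<phi>\<close>. The
      differential kills it, by \<open>comm\<close> and \<open>hs'\<close>, so exactness puts it
      into the image of the next differential, where a lift supplies \<open>s\<close>.\<close>
    let ?h = "\<lambda>x. \<phi> (Suc n) x \<ominus>\<^bsub>D (Suc n)\<^esub> s' (dC n x)"
    have sd: "(\<lambda>x. s' (dC n x)) \<in> mod_hom R (C (Suc n)) (D (Suc n))"
      by (rule mod_hom_comp[OF dC s'])
    have h: "?h \<in> mod_hom R (C (Suc n)) (D (Suc n))"
      by (rule mod_hom_diff[OF D \<phi> sd])
    have "?h x \<in> dD (Suc n) ` carrier (D (Suc (Suc n)))" if x: "x \<in> carrier (C (Suc n))" for x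
    proof (rule exact)
      show "?h x \<in> carrier (D (Suc n))" by (rule mod_hom_closed[OF h x])
      have "dD n (?h x) = dD n (\<phi> (Suc n) x) \<ominus>\<^bsub>D n\<^esub> dD n (s' (dC n x))"
        by (rule mod_hom_minus[OF D D dD mod_hom_closed[OF \<phi> x] mod_hom_closed[OF sd x]])
      also have "\<dots> = \<phi> n (dC n x) \<ominus>\<^bsub>D n\<^esub> \<phi> n (dC n x)"
        by (simp only: comm[OF x] hs'[OF x])
      also have "\<dots> = \<zero>\<^bsub>D n\<^esub>"
        using mod_hom_closed[OF \<phi> mod_hom_closed[OF dC x]] by (simp add: a_minus_def D'.M.r_neg)
      finally show "dD n (?h x) = \<zero>\<^bsub>D n\<^esub>" .
    qed
    then obtain s where s: "s \<in> mod_hom R (C (Suc n)) (D (Suc (Suc n)))"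
      "\<And>x. x \<in> carrier (C (Suc n)) \<Longrightarrow> dD (Suc n) (s x) = ?h x"
      using lift[OF h] by blast
    show ?thesis
    proof (intro bexI[OF _ s(1)] ballI)
      fix x assume x: "x \<in> carrier (C (Suc n))"
      show "\<phi> (Suc n) x = dD (Suc n) (s x) \<oplus>\<^bsub>D (Suc n)\<^esub> s' (dC n x)"
        using s(2)[OF x] mod_hom_closed[OF \<phi> x] mod_hom_closed[OF sd x]
        by (simp add: a_minus_def D.M.a_assoc D.M.l_neg)
    qed
  qed
  have "\<exists>s \<in> mod_hom R (C n) (D (Suc n)). \<forall>x \<in> carrier (C (Suc n)). dD n (s (dC n x)) = \<phi> n (dC n x)" for n
  proof (induction n)
    case 0
    then show ?case
      using s0(2) mod_hom_closed[OF dC] by (intro bexI[of _ s0]) (use s0(1) in auto)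
  next
    case (Suc n)
    then obtain s' where s': "s' \<in> mod_hom R (C n) (D (Suc n))"
      "\<And>x. x \<in> carrier (C (Suc n)) \<Longrightarrow> dD n (s' (dC n x)) = \<phi> n (dC n x)" by blast
    from step[OF this] obtain s where s: "s \<in> mod_hom R (C (Suc n)) (D (Suc (Suc n)))"
      "\<And>x. x \<in> carrier (C (Suc n)) \<Longrightarrow> \<phi> (Suc n) x = dD (Suc n) (s x) \<oplus>\<^bsub>D (Suc n)\<^esub> s' (dC n x)" by blast
    interpret D: module R "D (Suc n)" by (rule D)
    \<comment> \<open>On a boundary the term with \<open>s'\<close> vanishes because
      \<open>d d = 0\<close>; what remains of the homotopy identity is the invariant one degree
      higher.\<close>
    have "dD (Suc n) (s (dC (Suc n) x)) = \<phi> (Suc n) (dC (Suc n) x)" if x: "x \<in> carrier (C (Suc (Suc n)))" for x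
    proof -
      have y: "dC (Suc n) x \<in> carrier (C (Suc n))" by (rule mod_hom_closed[OF dC x])
      have "s' (dC n (dC (Suc n) x)) = \<zero>\<^bsub>D (Suc n)\<^esub>"
        by (simp only: dC2[OF x] mod_hom_zero[OF C D s'(1)])
      then show ?thesis
        using s(2)[OF y] mod_hom_closed[OF dD mod_hom_closed[OF s(1) y]] by simp
    qed
    then show ?case by (intro bexI[OF _ s(1)]) auto
  qed
  then obtain s' where "s' \<in> mod_hom R (C n) (D (Suc n))"
    "\<And>x. x \<in> carrier (C (Suc n)) \<Longrightarrow> dD n (s' (dC n x)) = \<phi> n (dC n x)" by blast
  from step[OF this] this(1) show "\<exists>s \<in> mod_hom R (C (Suc n)) (D (Suc (Suc n))). \<exists>s' \<in> mod_hom R (C n) (D (Suc n)).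
      \<forall>x \<in> carrier (C (Suc n)). \<phi> (Suc n) x = dD (Suc n) (s x) \<oplus>\<^bsub>D (Suc n)\<^esub> s' (dC n x)"
    by blast
qed

section \<open>Interleavings with zero\<close>

text \<open>The structure map over two steps of \<open>\<epsilon>\<close> factors through the
  one-element module, and the value of \<open>\<psi>\<close> at its element equals its own
  double.\<close>

lemma interleaved_zero_pmodD:
  fixes I :: "('i, 'k) monoid_scheme" and M :: "('i, 'r, 'm) pmod"
  assumes "comm_monoid I" "persistence_module R I M" "\<epsilon> \<in> carrier I" "interleaved R I \<epsilon> M zero_pmod"
    and "i \<in> carrier I" "x \<in> carrier (pcomp M i)"
  shows "pmap M i (i \<otimes>\<^bsub>I\<^esub> (\<epsilon> \<otimes>\<^bsub>I\<^esub> \<epsilon>)) x = \<zero>\<^bsub>pcomp M (i \<otimes>\<^bsub>I\<^esub> (\<epsilon> \<otimes>\<^bsub>I\<^esub> \<epsilon>))\<^esub>"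
proof -
  interpret I: comm_monoid I by fact
  let ?j = "i \<otimes>\<^bsub>I\<^esub> \<epsilon>" and ?k = "i \<otimes>\<^bsub>I\<^esub> (\<epsilon> \<otimes>\<^bsub>I\<^esub> \<epsilon>)"
  \<comment> \<open>\<open>\<psi>\<close> at \<open>?j\<close> lands at the left-bracketed index,
    while the interleaving condition names the right-bracketed one.\<close>
  have k: "?j \<otimes>\<^bsub>I\<^esub> \<epsilon> = ?k" using assms(3,5) by (simp add: I.m_assoc)
  interpret M: module R "pcomp M ?k"
    using assms(3,5) by (intro persistence_module_comp[OF assms(2)]) auto
  obtain \<phi> :: "'i \<Rightarrow> 'm \<Rightarrow> unit" and \<psi> where \<psi>: "\<psi> \<in> eps_hom R I \<epsilon> zero_pmod M"
    "\<psi> ?j (\<phi> i x) = pmap M i ?k x"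
    using assms(4-6) unfolding interleaved_def by blast
  have "\<psi> ?j \<in> mod_hom R (pcomp zero_pmod ?j) (pcomp M ?k)"
    using \<psi>(1) assms(3,5) by (auto simp: eps_hom_def k[symmetric])
  from mod_hom_add[OF this, of "()" "()"] mod_hom_closed[OF this, of "()"]
  have "\<psi> ?j () = \<psi> ?j () \<oplus>\<^bsub>pcomp M ?k\<^esub> \<psi> ?j ()" "\<psi> ?j () \<in> carrier (pcomp M ?k)"
    by (simp_all add: zero_pmod_def)
  then have "\<psi> ?j () = \<zero>\<^bsub>pcomp M ?k\<^esub>" by (metis M.M.add.r_cancel_one')
  with \<psi>(2) show ?thesis by simp
qed

text \<open>Both interleaving maps are forced to be zero. Naturality of the one out of zero says
  exactly that structure maps preserve zero, which for homology is a direct computation with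
  cosets.\<close>

lemma interleaved_zero_pmodI:
  assumes "comm_monoid I" "\<epsilon> \<in> carrier I" "\<And>i. i \<in> carrier I \<Longrightarrow> module R (pcomp M i)"
    and "\<And>i j. mon_le I i j \<Longrightarrow> pmap M i j \<zero>\<^bsub>pcomp M i\<^esub> = \<zero>\<^bsub>pcomp M j\<^esub>"
    and "\<And>i x. i \<in> carrier I \<Longrightarrow> x \<in> carrier (pcomp M i) \<Longrightarrow>
      pmap M i (i \<otimes>\<^bsub>I\<^esub> (\<epsilon> \<otimes>\<^bsub>I\<^esub> \<epsilon>)) x = \<zero>\<^bsub>pcomp M (i \<otimes>\<^bsub>I\<^esub> (\<epsilon> \<otimes>\<^bsub>I\<^esub> \<epsilon>))\<^esub>"
  shows "interleaved R I \<epsilon> M zero_pmod"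
proof -
  interpret I: comm_monoid I by fact
  have "(\<lambda>i x. ()) \<in> eps_hom R I \<epsilon> M zero_pmod"
    by (auto simp: eps_hom_def zero_pmod_def intro!: mod_homI)
  moreover have "(\<lambda>i x. \<zero>\<^bsub>pcomp M (i \<otimes>\<^bsub>I\<^esub> \<epsilon>)\<^esub>) \<in> eps_hom R I \<epsilon> zero_pmod M"
    using assms(2) by (auto simp: eps_hom_def assms(3,4) mon_le_add_mono[OF assms(1)] mod_hom_const_zero)
  moreover have "\<zero>\<^bsub>pcomp M (i \<otimes>\<^bsub>I\<^esub> \<epsilon> \<otimes>\<^bsub>I\<^esub> \<epsilon>)\<^esub> = pmap M i (i \<otimes>\<^bsub>I\<^esub> (\<epsilon> \<otimes>\<^bsub>I\<^esub> \<epsilon>)) x"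
    if "i \<in> carrier I" "x \<in> carrier (pcomp M i)" for i x
    using assms(2,5) that by (simp add: I.m_assoc)
  ultimately show ?thesis
    unfolding interleaved_def by (intro bexI[where x = "\<lambda>i x. ()"] bexI[where x = "\<lambda>i x. \<zero>\<^bsub>pcomp M (i \<otimes>\<^bsub>I\<^esub> \<epsilon>)\<^esub>"]) auto
qed

text \<open>Translates the claim to chains: a class dies over two steps of \<open>\<epsilon>\<close>
  because the structure map turns each representing cycle into a boundary.\<close>

lemma interleaved_homology_zero:
  assumes I: "comm_monoid I" and \<epsilon>: "\<epsilon> \<in> carrier I"
    and C: "\<And>n i. i \<in> carrier I \<Longrightarrow> module R (pcomp (C n) i)"
    and pm: "\<And>n i j. mon_le I i j \<Longrightarrow> pmap (C n) i j \<in> mod_hom R (pcomp (C n) i) (pcomp (C n) j)"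
    and d: "\<And>n. d n \<in> pmod_hom R I (C (Suc n)) (C n)"
    and d2: "\<And>n i x. i \<in> carrier I \<Longrightarrow> x \<in> carrier (pcomp (C (Suc (Suc n))) i) \<Longrightarrow>
      d n i (d (Suc n) i x) = \<zero>\<^bsub>pcomp (C n) i\<^esub>"
    and null: "\<And>i x. i \<in> carrier I \<Longrightarrow> x \<in> cycles C d n i \<Longrightarrow>
      pmap (C n) i (i \<otimes>\<^bsub>I\<^esub> (\<epsilon> \<otimes>\<^bsub>I\<^esub> \<epsilon>)) x \<in> boundaries C d n (i \<otimes>\<^bsub>I\<^esub> (\<epsilon> \<otimes>\<^bsub>I\<^esub> \<epsilon>))"
  shows "interleaved R I \<epsilon> (homology C d n) zero_pmod"
proof -
  interpret I: comm_monoid I by fact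
  have dh: "d n i \<in> mod_hom R (pcomp (C (Suc n)) i) (pcomp (C n) i)" if "i \<in> carrier I" for n i
    by (rule pmod_hom_comp[OF d that])
  have Z: "submodule (cycles C d n i) R (pcomp (C n) i)" if i: "i \<in> carrier I" for i
  proof (cases n)
    case 0
    then show ?thesis using module.carrier_is_submodule[OF C[OF i]] by (simp add: cycles_def)
  next
    case (Suc k)
    then show ?thesis using submodule_kernel[OF C[OF i] C[OF i] dh[OF i]] by (simp add: cycles_def)
  qed
  have B: "submodule (boundaries C d n i) R (pcomp (C n) i)" if i: "i \<in> carrier I" for i
    unfolding boundaries_def by (rule submodule_image[OF C[OF i] C[OF i] dh[OF i]])
  \<comment> \<open>In degree 0 every chain is a cycle; \<open>d2\<close> is needed in positive
    degrees only.\<close>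
  have BZ: "boundaries C d n i \<subseteq> cycles C d n i" if i: "i \<in> carrier I" for i
    using mod_hom_closed[OF dh[OF i]] d2[OF i]
    by (cases n) (auto simp: boundaries_def cycles_def a_kernel_eq)
  let ?H = "\<lambda>i. quot_mod ((pcomp (C n) i)\<lparr>carrier := cycles C d n i\<rparr>) (boundaries C d n i)"
  have Zm: "module R ((pcomp (C n) i)\<lparr>carrier := cycles C d n i\<rparr>)" if i: "i \<in> carrier I" for i
    by (rule submodule.submodule_is_module[OF Z[OF i] C[OF i]])
  have BZm: "submodule (boundaries C d n i) R ((pcomp (C n) i)\<lparr>carrier := cycles C d n i\<rparr>)"
    if i: "i \<in> carrier I" for i
    by (rule submodule_restrict[OF C[OF i] Z[OF i] B[OF i] BZ[OF i]])
  \<comment> \<open>The structure maps of homology are coset maps into the full chain module, so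
    they can be evaluated there. Boundaries go to boundaries since the differential is
    natural.\<close>
  have map: "coset_map (pcomp (C n) j) (boundaries C d n j) (pmap (C n) i j) (boundaries C d n i +>\<^bsub>pcomp (C n) i\<^esub> x)
      = boundaries C d n j +>\<^bsub>pcomp (C n) j\<^esub> pmap (C n) i j x"
    if ij: "mon_le I i j" and x: "x \<in> carrier (pcomp (C n) i)" for i j x
  proof (rule coset_map_coset[OF C[OF mon_leD(1)[OF ij]] C[OF mon_leD(2)[OF ij]]
        B[OF mon_leD(1)[OF ij]] B[OF mon_leD(2)[OF ij]] pm[OF ij] _ x])
    show "pmap (C n) i j ` boundaries C d n i \<subseteq> boundaries C d n j"
      using pmod_hom_natural[OF d ij] mod_hom_closed[OF pm[OF ij]] by (auto simp: boundaries_def)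
  qed
  have zero: "boundaries C d n j +>\<^bsub>pcomp (C n) j\<^esub> x = boundaries C d n j"
    if j: "j \<in> carrier I" and x: "x \<in> boundaries C d n j" for j x
    using quot_mod_coset_eq_zero[OF C[OF j] B[OF j] x] by (simp add: quot_mod_simps)
  have zeroB: "\<zero>\<^bsub>pcomp (C n) j\<^esub> \<in> boundaries C d n j" if j: "j \<in> carrier I" for j
    using subgroup.one_closed[OF submodule.axioms(1)[OF B[OF j]]] by simp
  show ?thesis
  proof (rule interleaved_zero_pmodI[OF I \<epsilon>])
    show "module R (pcomp (homology C d n) i)" if i: "i \<in> carrier I" for i
      using module_quot_mod[OF Zm[OF i] BZm[OF i]] by (simp add: homology_def)
  next
    fix i j assume ij: "mon_le I i j"
    note i = mon_leD(1)[OF ij] and j = mon_leD(2)[OF ij]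
    interpret Ci: module R "pcomp (C n) i" by (rule C[OF i])
    \<comment> \<open>The zero class is the set of boundaries itself; it is rewritten as the coset
      of the zero chain so that \<open>map\<close> applies.\<close>
    have "coset_map (pcomp (C n) j) (boundaries C d n j) (pmap (C n) i j) (boundaries C d n i) = boundaries C d n j"
      using map[OF ij Ci.M.zero_closed] mod_hom_zero[OF C[OF i] C[OF j] pm[OF ij]]
      by (simp only: zero[OF i zeroB[OF i]] zero[OF j zeroB[OF j]])
    then show "pmap (homology C d n) i j \<zero>\<^bsub>pcomp (homology C d n) i\<^esub> = \<zero>\<^bsub>pcomp (homology C d n) j\<^esub>"
      by (simp add: homology_def quot_mod_simps)
  next
    fix i X assume i: "i \<in> carrier I" and X: "X \<in> carrier (pcomp (homology C d n) i)"
    let ?k = "i \<otimes>\<^bsub>I\<^esub> (\<epsilon> \<otimes>\<^bsub>I\<^esub> \<epsilon>)"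
    have ik: "mon_le I i ?k" using mon_le_add[OF I i, of "\<epsilon> \<otimes>\<^bsub>I\<^esub> \<epsilon>"] \<epsilon> by simp
    have "X \<in> carrier (?H i)" using X by (simp add: homology_def)
    then obtain x where x: "x \<in> cycles C d n i" "X = boundaries C d n i +>\<^bsub>pcomp (C n) i\<^esub> x"
      by (rule quot_modE) (simp add: a_r_coset_restrict)
    have "x \<in> carrier (pcomp (C n) i)"
      using x(1) module.submoduleE(1)[OF C[OF i] Z[OF i]] by auto
    then show "pmap (homology C d n) i ?k X = \<zero>\<^bsub>pcomp (homology C d n) ?k\<^esub>"
      using map[OF ik] zero[OF mon_leD(2)[OF ik] null[OF i x(1)]] x(2)
      by (simp add: homology_def quot_mod_simps)
  qed
qed

section \<open>The torsion of a persistence module that is interleaved with zero\<close>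

lemma ptensor_simps:
  "pcomp (ptensor R M N) i = tensor_mod R (pcomp M i) (pcomp N i)"
  "pmap (ptensor R M N) i j = tensor_map R (pcomp M j) (pcomp N j) (pmap M i j) (pmap N i j)"
  by (simp_all add: ptensor_def)

text \<open>Puts exactness into the elementwise form that the homotopy construction consumes. The
  complex property is one inclusion of the equality between boundaries and cycles.\<close>

lemma projective_resolutionD:
  assumes "projective_resolution R I A P d \<eta>"
  shows projective_resolution_projective: "projective_pmod R I (P n)"
    and projective_resolution_pmod: "persistence_module R I (P n)"
    and projective_resolution_diff: "d n \<in> pmod_hom R I (P (Suc n)) (P n)"
    and projective_resolution_augm: "\<eta> \<in> pmod_hom R I (P 0) A"
    and projective_resolution_exact0: "i \<in> carrier I \<Longrightarrow> x \<in> carrier (pcomp (P 0) i) \<Longrightarrow>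
      \<eta> i x = \<zero>\<^bsub>pcomp A i\<^esub> \<Longrightarrow> x \<in> d 0 i ` carrier (pcomp (P (Suc 0)) i)"
    and projective_resolution_exact: "i \<in> carrier I \<Longrightarrow> x \<in> carrier (pcomp (P (Suc n)) i) \<Longrightarrow>
      d n i x = \<zero>\<^bsub>pcomp (P n) i\<^esub> \<Longrightarrow> x \<in> d (Suc n) i ` carrier (pcomp (P (Suc (Suc n))) i)"
    and projective_resolution_complex: "i \<in> carrier I \<Longrightarrow> x \<in> carrier (pcomp (P (Suc (Suc n))) i) \<Longrightarrow>
      d n i (d (Suc n) i x) = \<zero>\<^bsub>pcomp (P n) i\<^esub>"
proof -
  note pr = assms[unfolded projective_resolution_def]
  show "projective_pmod R I (P n)" "d n \<in> pmod_hom R I (P (Suc n)) (P n)" "\<eta> \<in> pmod_hom R I (P 0) A"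
    using pr by auto
  then show "persistence_module R I (P n)" by (simp add: projective_pmod_def)
  have "boundaries P d 0 i = a_kernel (pcomp (P 0) i) (pcomp A i) (\<eta> i)" if "i \<in> carrier I"
    using pr that by auto
  then show "x \<in> d 0 i ` carrier (pcomp (P (Suc 0)) i)"
    if "i \<in> carrier I" "x \<in> carrier (pcomp (P 0) i)" "\<eta> i x = \<zero>\<^bsub>pcomp A i\<^esub>"
    using that by (simp add: boundaries_def a_kernel_eq)
  have "boundaries P d (Suc n) i = cycles P d (Suc n) i" if "i \<in> carrier I"
    using pr that by auto
  then have e: "d (Suc n) i ` carrier (pcomp (P (Suc (Suc n))) i)
      = {x \<in> carrier (pcomp (P (Suc n)) i). d n i x = \<zero>\<^bsub>pcomp (P n) i\<^esub>}" if "i \<in> carrier I"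
    using that by (simp add: boundaries_def cycles_def a_kernel_eq)
  show "x \<in> d (Suc n) i ` carrier (pcomp (P (Suc (Suc n))) i)"
    if "i \<in> carrier I" "x \<in> carrier (pcomp (P (Suc n)) i)" "d n i x = \<zero>\<^bsub>pcomp (P n) i\<^esub>"
    using that by (simp add: e)
  show "d n i (d (Suc n) i x) = \<zero>\<^bsub>pcomp (P n) i\<^esub>"
    if "i \<in> carrier I" "x \<in> carrier (pcomp (P (Suc (Suc n))) i)"
    using e[OF that(1)] that(2) by blast
qed

text \<open>Uniqueness of lifts up to homotopy, for a map lifting zero. Naturality of
  \<open>\<eta>\<close> and the vanishing on \<open>A\<close> place the shift of \<open>P 0\<close>
  in the kernel of \<open>\<eta> j\<close>, that is, in the image of \<open>d 0 j\<close>, where the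
  homotopy starts.\<close>

lemma resolution_shift_null_homotopy:
  assumes "cring R" "comm_monoid I" "persistence_module R I A" "projective_resolution R I A P d \<eta>"
    and ij: "mon_le I i j"
    and zero: "\<And>x. x \<in> carrier (pcomp A i) \<Longrightarrow> pmap A i j x = \<zero>\<^bsub>pcomp A j\<^esub>"
  shows "\<exists>s \<in> mod_hom R (pcomp (P 0) i) (pcomp (P (Suc 0)) j). \<forall>x \<in> carrier (pcomp (P 0) i).
      pmap (P 0) i j x = d 0 j (s x)"
    and "\<exists>s \<in> mod_hom R (pcomp (P (Suc n)) i) (pcomp (P (Suc (Suc n))) j).
      \<exists>s' \<in> mod_hom R (pcomp (P n) i) (pcomp (P (Suc n)) j). \<forall>x \<in> carrier (pcomp (P (Suc n)) i).
      pmap (P (Suc n)) i j x = d (Suc n) j (s x) \<oplus>\<^bsub>pcomp (P (Suc n)) j\<^esub> s' (d n i x)"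
proof -
  note i = mon_leD(1)[OF ij] and j = mon_leD(2)[OF ij]
  note res = assms(4)
  have aug: "pmap (P 0) i j x \<in> d 0 j ` carrier (pcomp (P (Suc 0)) j)"
    if x: "x \<in> carrier (pcomp (P 0) i)" for x
  proof (rule projective_resolution_exact0[OF res j])
    show "pmap (P 0) i j x \<in> carrier (pcomp (P 0) j)"
      by (rule mod_hom_closed[OF persistence_module_map[OF projective_resolution_pmod[OF res] ij] x])
    show "\<eta> j (pmap (P 0) i j x) = \<zero>\<^bsub>pcomp A j\<^esub>"
      using pmod_hom_natural[OF projective_resolution_augm[OF res] ij x] zero[OF mod_hom_closed[OF pmod_hom_comp[OF projective_resolution_augm[OF res] i] x]]
      by simp
  qed
  note comp = persistence_module_comp[OF projective_resolution_pmod[OF res]]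
  \<comment> \<open>The two complexes have different roles: projectivity is used at
    \<open>i\<close>, exactness at \<open>j\<close>.\<close>
  note H = null_homotopy[where C = "\<lambda>n. pcomp (P n) i" and D = "\<lambda>n. pcomp (P n) j"
      and dC = "\<lambda>n. d n i" and dD = "\<lambda>n. d n j" and \<phi> = "\<lambda>n. pmap (P n) i j",
      OF comp[OF i] comp[OF j] pmod_hom_comp[OF projective_resolution_diff[OF res] i] pmod_hom_comp[OF projective_resolution_diff[OF res] j]
      projective_resolution_complex[OF res i] projective_resolution_exact[OF res j] persistence_module_map[OF projective_resolution_pmod[OF res] ij]
      pmod_hom_natural[OF projective_resolution_diff[OF res] ij, symmetric] aug
      projective_pmod_component_lift[OF assms(1,2) projective_resolution_projective[OF res] i comp[OF j] comp[OF j] pmod_hom_comp[OF projective_resolution_diff[OF res] j]]]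
  show "\<exists>s \<in> mod_hom R (pcomp (P 0) i) (pcomp (P (Suc 0)) j). \<forall>x \<in> carrier (pcomp (P 0) i).
      pmap (P 0) i j x = d 0 j (s x)"
    by (rule H(1))
  show "\<exists>s \<in> mod_hom R (pcomp (P (Suc n)) i) (pcomp (P (Suc (Suc n))) j).
      \<exists>s' \<in> mod_hom R (pcomp (P n) i) (pcomp (P (Suc n)) j). \<forall>x \<in> carrier (pcomp (P (Suc n)) i).
      pmap (P (Suc n)) i j x = d (Suc n) j (s x) \<oplus>\<^bsub>pcomp (P (Suc n)) j\<^esub> s' (d n i x)"
    by (rule H(2))
qed

theorem proposition24:
  fixes R :: "('r, 'c) ring_scheme"
    and I :: "('i, 'k) monoid_scheme"
    and A :: "('i, 'r, 'a) pmod"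
    and B :: "('i, 'r, 'b) pmod"
    and P :: "nat \<Rightarrow> ('i, 'r, 'p) pmod"
    and d :: "nat \<Rightarrow> 'i \<Rightarrow> 'p \<Rightarrow> 'p"
    and \<eta> :: "'i \<Rightarrow> 'p \<Rightarrow> 'a"
    and \<epsilon> :: 'i
    and n :: nat
  assumes "cring R"
    and "comm_monoid I"
    and "persistence_module R I A"
    and "persistence_module R I B"
    and "(noetherian_ring R \<and> I \<cong> nat_add_monoid \<and> finite_type R I A \<and> finite_type R I B)
       \<or> (good_monoid I \<and> fin_pres_type R I A \<and> fin_pres_type R I B)"
    and "\<epsilon> \<in> carrier I"
    and "interleaved R I \<epsilon> A zero_pmod \<or> interleaved R I \<epsilon> B zero_pmod"
    and "projective_resolution R I A P d \<eta>"
  shows "interleaved R I \<epsilon> (Tor R P d B n) zero_pmod"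
proof -
  interpret I: comm_monoid I by fact
  note res = assms(8)
  note Pm = persistence_moduleD[OF projective_resolution_pmod[OF res]] and Bm = persistence_moduleD[OF assms(4)]
  note dh = pmod_hom_comp[OF projective_resolution_diff[OF res]]
  let ?T = "\<lambda>k. ptensor R (P k) B"
  let ?d = "\<lambda>k i. tensor_map R (pcomp (P k) i) (pcomp B i) (d k i) (\<lambda>b. b)"
  have T: "module R (pcomp (?T k) i)" if "i \<in> carrier I" for k i
    using module_tensor_mod[OF Pm(1)[OF that] Bm(1)[OF that]] by (simp only: ptensor_simps)
  have Td: "?d k i \<in> mod_hom R (pcomp (?T (Suc k)) i) (pcomp (?T k) i)" if "i \<in> carrier I" for k i
    unfolding ptensor_simps
    by (rule tensor_map_hom[OF Pm(1) Bm(1) Pm(1) Bm(1) dh mod_hom_id]) (rule that)+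
  \<comment> \<open>One composition rule with freely varying degrees and indices; it yields
    naturality of the differentials, \<open>d d = 0\<close>, and the factorizations of the two
    homotopy terms.\<close>
  have comp: "tensor_map R (pcomp (P k'') i'') (pcomp B i'') f' g' (tensor_map R (pcomp (P k') i') (pcomp B i') f g X)
      = tensor_map R (pcomp (P k'') i'') (pcomp B i'') h g'' X"
    if "i \<in> carrier I" "i' \<in> carrier I" "i'' \<in> carrier I"
      "f \<in> mod_hom R (pcomp (P k) i) (pcomp (P k') i')" "g \<in> mod_hom R (pcomp B i) (pcomp B i')"
      "f' \<in> mod_hom R (pcomp (P k') i') (pcomp (P k'') i'')" "g' \<in> mod_hom R (pcomp B i') (pcomp B i'')"
      "\<And>x. x \<in> carrier (pcomp (P k) i) \<Longrightarrow> h x = f' (f x)"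
      "\<And>x. x \<in> carrier (pcomp B i) \<Longrightarrow> g'' x = g' (g x)"
      "X \<in> carrier (tensor_mod R (pcomp (P k) i) (pcomp B i))" for k k' k'' i i' i'' f g f' g' h g'' X
    by (rule tensor_map_comp[OF Pm(1) Bm(1) Pm(1) Bm(1) Pm(1) Bm(1) that(4-10)]) (rule that(1-3))+
  have "interleaved R I \<epsilon> (homology ?T ?d n) zero_pmod"
  proof (rule interleaved_homology_zero[OF assms(2,6)])
    show "module R (pcomp (?T k) i)" if "i \<in> carrier I" for k i
      by (rule T[OF that])
    show "pmap (?T k) i j \<in> mod_hom R (pcomp (?T k) i) (pcomp (?T k) j)" if "mon_le I i j" for k i j
      unfolding ptensor_simps
      by (rule tensor_map_hom[OF Pm(1) Bm(1) Pm(1) Bm(1) Pm(2) Bm(2)]) (rule that mon_leD[OF that])+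
    show "?d k \<in> pmod_hom R I (?T (Suc k)) (?T k)" for k
    proof -
      have "pmap (?T k) i j (?d k i X) = ?d k j (pmap (?T (Suc k)) i j X)"
        if ij: "mon_le I i j" and X: "X \<in> carrier (pcomp (?T (Suc k)) i)" for i j X
      proof -
        note i = mon_leD(1)[OF ij] and j = mon_leD(2)[OF ij]
        have "pmap (?T k) i j (?d k i X) =
            tensor_map R (pcomp (P k) j) (pcomp B j) (\<lambda>x. pmap (P k) i j (d k i x)) (pmap B i j) X"
          using X unfolding ptensor_simps
          by (intro comp[OF i i j dh[OF i] mod_hom_id Pm(2)[OF ij] Bm(2)[OF ij]]) auto
        also have "\<dots> = ?d k j (pmap (?T (Suc k)) i j X)"
          using X pmod_hom_natural[OF projective_resolution_diff[OF res] ij] unfolding ptensor_simps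
          by (intro comp[OF i j j Pm(2)[OF ij] Bm(2)[OF ij] dh[OF j] mod_hom_id, symmetric]) auto
        finally show ?thesis .
      qed
      then show ?thesis using Td by (simp add: pmod_hom_def)
    qed
    show "?d k i (?d (Suc k) i X) = \<zero>\<^bsub>pcomp (?T k) i\<^esub>"
      if i: "i \<in> carrier I" and X: "X \<in> carrier (pcomp (?T (Suc (Suc k))) i)" for k i X
    proof -
      have "?d k i (?d (Suc k) i X) =
          tensor_map R (pcomp (P k) i) (pcomp B i) (\<lambda>x. d k i (d (Suc k) i x)) (\<lambda>b. b) X"
        using X unfolding ptensor_simps
        by (intro comp[OF i i i dh[OF i] mod_hom_id dh[OF i] mod_hom_id]) auto
      also have "\<dots> = \<zero>\<^bsub>pcomp (?T k) i\<^esub>"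
        using X unfolding ptensor_simps
        by (intro tensor_map_zero_left[OF Pm(1)[OF i] Bm(1)[OF i] Pm(1)[OF i] Bm(1)[OF i] mod_hom_id]
            projective_resolution_complex[OF res i])
      finally show ?thesis .
    qed
  next
    fix i X assume i: "i \<in> carrier I" and X: "X \<in> cycles ?T ?d n i"
    let ?j = "i \<otimes>\<^bsub>I\<^esub> (\<epsilon> \<otimes>\<^bsub>I\<^esub> \<epsilon>)"
    have ij: "mon_le I i ?j" and j: "?j \<in> carrier I"
      using mon_le_add[OF assms(2) i] assms(6) i by auto
    interpret Tj: module R "pcomp (?T n) ?j" by (rule T[OF j])
    have Xc: "X \<in> carrier (tensor_mod R (pcomp (P n) i) (pcomp B i))"
      using X by (cases n) (auto simp: cycles_def a_kernel_eq ptensor_simps)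
    note \<beta> = Bm(2)[OF ij]
    note mods = Pm(1)[OF i] Bm(1)[OF i] Pm(1)[OF j] Bm(1)[OF j]
    show "pmap (?T n) i ?j X \<in> boundaries ?T ?d n ?j"
    proof (cases "interleaved R I \<epsilon> B zero_pmod")
      case True
      have "pmap (?T n) i ?j X = \<zero>\<^bsub>pcomp (?T n) ?j\<^esub>"
        unfolding ptensor_simps
        by (intro tensor_map_zero_right[OF mods Pm(2)[OF ij] _ Xc]
            interleaved_zero_pmodD[OF assms(2,4,6) True i])
      \<comment> \<open>Zero is a boundary, namely that of the zero chain.\<close>
      also have "\<dots> = ?d n ?j \<zero>\<^bsub>pcomp (?T (Suc n)) ?j\<^esub>"
        by (rule mod_hom_zero[OF T[OF j] T[OF j] Td[OF j], symmetric])
      finally show ?thesis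
        using abelian_monoid.zero_closed[OF abelian_group.axioms(1)[OF module.axioms(2)[OF T[OF j]]]]
        unfolding boundaries_def by (rule image_eqI)
    next
      case False
      then have A0: "interleaved R I \<epsilon> A zero_pmod" using assms(7) by simp
      note homotopy = resolution_shift_null_homotopy[OF assms(1-3,8) ij
          interleaved_zero_pmodD[OF assms(2,3,6) A0 i]]
      \<comment> \<open>\<open>(d s) \<otimes> \<beta>\<close> factors as
        \<open>(d \<otimes> id)(s \<otimes> \<beta>)\<close>. The structure map of \<open>B\<close>
        is absorbed into the first step, so the second is the differential of the tensored complex
        at \<open>?j\<close>.\<close>
      have bdry: "tensor_map R (pcomp (P n) ?j) (pcomp B ?j) (\<lambda>x. d n ?j (s x)) (pmap B i ?j) X
          \<in> boundaries ?T ?d n ?j"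
        if s: "s \<in> mod_hom R (pcomp (P n) i) (pcomp (P (Suc n)) ?j)" for s
      proof -
        have "tensor_map R (pcomp (P n) ?j) (pcomp B ?j) (\<lambda>x. d n ?j (s x)) (pmap B i ?j) X =
            ?d n ?j (tensor_map R (pcomp (P (Suc n)) ?j) (pcomp B ?j) s (pmap B i ?j) X)"
          by (rule comp[OF i j j s \<beta> dh[OF j] mod_hom_id _ _ Xc, symmetric]) auto
        moreover have "tensor_map R (pcomp (P (Suc n)) ?j) (pcomp B ?j) s (pmap B i ?j) X
            \<in> carrier (pcomp (?T (Suc n)) ?j)"
          unfolding ptensor_simps
          by (rule mod_hom_closed[OF tensor_map_hom[OF Pm(1)[OF i] Bm(1)[OF i] Pm(1)[OF j] Bm(1)[OF j] s \<beta>] Xc])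
        ultimately show ?thesis
          unfolding boundaries_def by (rule image_eqI)
      qed
      show ?thesis
      proof (cases n)
        case 0
        obtain s where s: "s \<in> mod_hom R (pcomp (P n) i) (pcomp (P (Suc n)) ?j)"
          "\<And>x. x \<in> carrier (pcomp (P n) i) \<Longrightarrow> pmap (P n) i ?j x = d n ?j (s x)"
          using homotopy(1) unfolding 0 by blast
        \<comment> \<open>In degree 0 the homotopy has a single term, and the two maps agree on the
          carrier only; hence \<open>tensor_map_cong\<close>.\<close>
        have "tensor_map R (pcomp (P n) ?j) (pcomp B ?j) (pmap (P n) i ?j) (pmap B i ?j) X =
            tensor_map R (pcomp (P n) ?j) (pcomp B ?j) (\<lambda>x. d n ?j (s x)) (pmap B i ?j) X"
          by (rule tensor_map_cong[OF mods mod_hom_comp[OF s(1) dh[OF j]] \<beta> s(2) Xc])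
        then show ?thesis using bdry[OF s(1)] by (simp only: ptensor_simps)
      next
        case (Suc m)
        obtain s s' where s: "s \<in> mod_hom R (pcomp (P n) i) (pcomp (P (Suc n)) ?j)"
          and s': "s' \<in> mod_hom R (pcomp (P m) i) (pcomp (P n) ?j)"
          and h: "\<And>x. x \<in> carrier (pcomp (P n) i) \<Longrightarrow>
            pmap (P n) i ?j x = d n ?j (s x) \<oplus>\<^bsub>pcomp (P n) ?j\<^esub> s' (d m i x)"
          using homotopy(2)[of m] unfolding Suc by blast
        have dm: "d m i \<in> mod_hom R (pcomp (P n) i) (pcomp (P m) i)"
          using dh[OF i, of m] by (simp only: Suc)
        have dX: "?d m i X = \<zero>\<^bsub>tensor_mod R (pcomp (P m) i) (pcomp B i)\<^esub>"
          using X by (simp add: Suc cycles_def a_kernel_eq ptensor_simps)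
        \<comment> \<open>Here the structure map of \<open>B\<close> goes with \<open>s'\<close>
          instead: \<open>(s' d) \<otimes> \<beta>\<close> applies the differential at
          \<open>i\<close> first, which kills the cycle \<open>X\<close>.\<close>
        have "tensor_map R (pcomp (P n) ?j) (pcomp B ?j) (\<lambda>x. s' (d m i x)) (pmap B i ?j) X =
            tensor_map R (pcomp (P n) ?j) (pcomp B ?j) s' (pmap B i ?j) (?d m i X)"
          by (rule comp[OF i i j dm mod_hom_id s' \<beta> _ _ Xc, symmetric]) auto
        also have "\<dots> = \<zero>\<^bsub>pcomp (?T n) ?j\<^esub>"
          unfolding dX ptensor_simps
          by (rule mod_hom_zero[OF module_tensor_mod module_tensor_mod tensor_map_hom[OF _ _ _ _ s' \<beta>]])
            (rule Pm(1) Bm(1) i j)+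
        finally have 0: "tensor_map R (pcomp (P n) ?j) (pcomp B ?j) (\<lambda>x. s' (d m i x)) (pmap B i ?j) X =
          \<zero>\<^bsub>pcomp (?T n) ?j\<^esub>" .
        \<comment> \<open>The tensored homotopy identity: its second summand is zero on
          \<open>X\<close> and its first is a boundary by \<open>bdry\<close>.\<close>
        have "pmap (?T n) i ?j X =
            tensor_map R (pcomp (P n) ?j) (pcomp B ?j) (\<lambda>x. d n ?j (s x)) (pmap B i ?j) X
            \<oplus>\<^bsub>pcomp (?T n) ?j\<^esub>
            tensor_map R (pcomp (P n) ?j) (pcomp B ?j) (\<lambda>x. s' (d m i x)) (pmap B i ?j) X"
          unfolding ptensor_simps
          by (rule tensor_map_add_left[OF mods mod_hom_comp[OF s dh[OF j]] mod_hom_comp[OF dm s'] \<beta> h Xc])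
        moreover have "tensor_map R (pcomp (P n) ?j) (pcomp B ?j) (\<lambda>x. d n ?j (s x)) (pmap B i ?j) X
            \<in> carrier (pcomp (?T n) ?j)"
          unfolding ptensor_simps
          by (rule mod_hom_closed[OF tensor_map_hom[OF mods mod_hom_comp[OF s dh[OF j]] \<beta>] Xc])
        ultimately show ?thesis using bdry[OF s] by (simp only: 0 Tj.M.r_zero)
      qed
    qed
  qed
  then show ?thesis by (simp only: Tor_def)
qed

end
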